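(* Let $n\ge 359$ be an integer, and let $a$ be the unique positive odd integer such that $a^2-2\le n\le (a+2)^2-3$. Then $$M(n)\le \frac{(a^2-2)(a^2-1)}{2}.$$
   Context: $\mathbb{S}^{n-1}$ denotes the unit sphere in $\mathbb{R}^n$. An equiangular set in $\mathbb{S}^{n-1}$ is a finite set $X\subset\mathbb{S}^{n-1}$ for which there is $\alpha\in[0,1)$ such that the scalar product of any two distinct points of $X$ belongs to $\{\alpha,-\alpha\}$. $M(n)$ denotes the maximum cardinality of an equiangular set in $\mathbb{S}^{n-1}$. *)

theory Defs
  imports "HOL-Analysis.Analysis"
begin

definition equiangular_set :: "'a::real_inner set \<Rightarrow> bool" where
  "equiangular_set X \<longleftrightarrow> finite X \<and> X \<subseteq> sphere 0 1 \<and>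
     (\<exists>\<alpha>\<in>{0..<1}. \<forall>x\<in>X. \<forall>y\<in>X. x \<noteq> y \<longrightarrow> x \<bullet> y \<in> {\<alpha>, - \<alpha>})"

text \<open>
  The dimension \<open>n\<close> is \<open>CARD('n)\<close>, so \<open>M(n)\<close> takes the index type as its argument.
  \<open>Max\<close> is unspecified on infinite sets; an upper bound on \<open>max_equiangular\<close> can therefore
  only be obtained together with the boundedness of the set of cardinalities.
\<close>

definition max_equiangular :: "'n::finite itself \<Rightarrow> nat" where
  "max_equiangular _ = Max {card X | X :: (real ^ 'n) set. equiangular_set X}"

lemma ex1_odd_parameter:
  fixes n :: nat
  shows "\<exists>!a::int. 0 < a \<and> odd a \<and> a\<^sup>2 - 2 \<le> int n \<and> int n \<le> (a + 2)\<^sup>2 - 3"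
proof -
  define k where "k = (LEAST k::nat. int n \<le> (2 * int k + 3)\<^sup>2 - 3)"
  have k: "int n \<le> (2 * int k + 3)\<^sup>2 - 3"
    unfolding k_def by (rule LeastI[of _ n]) (simp add: power2_eq_square algebra_simps)
  have lower: "(2 * int k + 1)\<^sup>2 - 2 \<le> int n"
  proof (cases k)
    case (Suc j)
    then have "\<not> int n \<le> (2 * int j + 3)\<^sup>2 - 3"
      using not_less_Least[of j "\<lambda>k. int n \<le> (2 * int k + 3)\<^sup>2 - 3"] by (simp add: k_def)
    then show ?thesis using Suc by (simp add: algebra_simps)
  qed simp
  have uniq: "a \<le> b"
    if a: "0 < a" "odd a" "a\<^sup>2 - 2 \<le> int n"
    and b: "0 < b" "odd b" "int n \<le> (b + 2)\<^sup>2 - 3" for a b :: int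
  proof (rule ccontr)
    assume "\<not> a \<le> b"
    with a b have "b + 2 \<le> a" by presburger
    then have "(b + 2)\<^sup>2 \<le> a\<^sup>2" using b by (intro power_mono) auto
    with a b show False by linarith
  qed
  show ?thesis
  proof (rule ex1I[of _ "2 * int k + 1"])
    show "0 < 2 * int k + 1 \<and> odd (2 * int k + 1) \<and> (2 * int k + 1)\<^sup>2 - 2 \<le> int n
        \<and> int n \<le> (2 * int k + 1 + 2)\<^sup>2 - 3"
      using k lower by (simp add: add.assoc)
    then show "a = 2 * int k + 1"
      if "0 < a \<and> odd a \<and> a\<^sup>2 - 2 \<le> int n \<and> int n \<le> (a + 2)\<^sup>2 - 3" for a
      using that uniq by (intro antisym) blast+
  qed
qed

end

theory Submission
  imports Defs "Jordan_Normal_Form.Char_Poly"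
begin

text \<open>
  Let \<open>X\<close> be equiangular with \<open>N\<close> points and angle \<open>\<alpha> = 1/b\<close> in dimension \<open>n\<close>, and suppose that \<open>N\<close> exceeds
  the bound. If \<open>b\<^sup>2 \<ge> n + 3\<close>, then the relative bound gives \<open>N \<le> n (n + 2) / 3\<close>, which is too small.
  Otherwise \<open>b\<close> is an odd integer by Neumann's argument, so \<open>b \<le> a\<close>. If \<open>n\<close> is at most about \<open>3 b\<^sup>2\<close>, then
  the positivity of the zonal functions of degree one and three on the vectors projected along a point
  of \<open>X\<close> gives \<open>N \<le> (b\<^sup>2 - 1) (b\<^sup>2 - 2) / 2\<close> (Okuda and Yu). If \<open>n\<close> is larger, then Balla's projection of the
  matrices \<open>v w\<^sup>T + w v\<^sup>T\<close> onto the span of the \<open>x x\<^sup>T\<close> shows that every entry of the squared Gram matrix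
  has modulus close to \<open>N \<alpha>\<^sup>2\<close>. The frame operator \<open>F\<close> then has an eigenvalue close to the maximal
  possible value \<open>L = 1 + (N - 1) \<alpha>\<close>, and the rank bound for \<open>F - F\<^sup>2 / L\<close> gives roughly
  \<open>N \<le> n b\<^sup>4 / (2 (b - 1)\<^sup>2)\<close>, which is again too small.
\<close>

no_notation scalar_prod (infix "\<bullet>" 70)

section \<open>Trace inequalities for frames\<close>

text \<open>Cauchy-Schwarz on the diagonal; adding the off-diagonal squares then completes the
  squared Frobenius norm. The dimension stands in for the rank.\<close>

lemma trace_sq_le:
  fixes M :: "'a::euclidean_space \<Rightarrow> 'a \<Rightarrow> real"
  shows "(\<Sum>i\<in>Basis. M i i)\<^sup>2 \<le> DIM('a) * (\<Sum>i\<in>Basis. \<Sum>j\<in>Basis. (M i j)\<^sup>2)"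
proof -
  have "(\<Sum>i\<in>Basis. M i i)\<^sup>2 \<le> DIM('a) * (\<Sum>i\<in>Basis. (M i i)\<^sup>2)"
    using sum_squared_le_sum_of_squares[of "\<lambda>i. M i i" "Basis :: 'a set"]
    by (simp add: mult.commute)
  also have "\<dots> \<le> DIM('a) * (\<Sum>i\<in>Basis. \<Sum>j\<in>Basis. (M i j)\<^sup>2)"
    by (intro mult_left_mono sum_mono member_le_sum) auto
  finally show ?thesis .
qed

text \<open>This is the Frobenius inner product of the sum of the u_k v_k^T with the sum of the w_l
  z_l^T. Matrices are written as functions of two basis vectors, so that such products reduce to
  scalar products of the generating vectors.\<close>

lemma sum_Basis_rank_one_mult:
  fixes u v :: "'b \<Rightarrow> 'a::euclidean_space" and w z :: "'c \<Rightarrow> 'a"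
  shows "(\<Sum>i\<in>Basis. \<Sum>j\<in>Basis. (\<Sum>k\<in>I. (u k \<bullet> i) * (v k \<bullet> j)) * (\<Sum>l\<in>J. (w l \<bullet> i) * (z l \<bullet> j)))
       = (\<Sum>k\<in>I. \<Sum>l\<in>J. (u k \<bullet> w l) * (v k \<bullet> z l))"
proof -
  have "(\<Sum>i\<in>Basis. \<Sum>j\<in>Basis. (\<Sum>k\<in>I. (u k \<bullet> i) * (v k \<bullet> j)) * (\<Sum>l\<in>J. (w l \<bullet> i) * (z l \<bullet> j)))
      = (\<Sum>i\<in>Basis. \<Sum>j\<in>Basis. \<Sum>k\<in>I. \<Sum>l\<in>J. ((u k \<bullet> i) * (w l \<bullet> i)) * ((v k \<bullet> j) * (z l \<bullet> j)))"
    by (simp add: sum_product mult_ac)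
  also have "\<dots> = (\<Sum>i\<in>Basis. \<Sum>k\<in>I. \<Sum>j\<in>Basis. \<Sum>l\<in>J. ((u k \<bullet> i) * (w l \<bullet> i)) * ((v k \<bullet> j) * (z l \<bullet> j)))"
    by (intro sum.cong refl sum.swap)
  also have "\<dots> = (\<Sum>i\<in>Basis. \<Sum>k\<in>I. \<Sum>l\<in>J. \<Sum>j\<in>Basis. ((u k \<bullet> i) * (w l \<bullet> i)) * ((v k \<bullet> j) * (z l \<bullet> j)))"
    by (intro sum.cong refl sum.swap)
  also have "\<dots> = (\<Sum>i\<in>Basis. \<Sum>k\<in>I. \<Sum>l\<in>J. ((u k \<bullet> i) * (w l \<bullet> i)) * (v k \<bullet> z l))"
    by (simp add: sum_distrib_left[symmetric] euclidean_inner[symmetric])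
  also have "\<dots> = (\<Sum>k\<in>I. \<Sum>i\<in>Basis. \<Sum>l\<in>J. ((u k \<bullet> i) * (w l \<bullet> i)) * (v k \<bullet> z l))"
    by (rule sum.swap)
  also have "\<dots> = (\<Sum>k\<in>I. \<Sum>l\<in>J. \<Sum>i\<in>Basis. ((u k \<bullet> i) * (w l \<bullet> i)) * (v k \<bullet> z l))"
    by (intro sum.cong refl sum.swap)
  also have "\<dots> = (\<Sum>k\<in>I. \<Sum>l\<in>J. (u k \<bullet> w l) * (v k \<bullet> z l))"
    by (simp add: sum_distrib_right[symmetric] euclidean_inner[symmetric])
  finally show ?thesis .
qed

text \<open>The trace inequality for the sum of the u_k v_k^T, freed of coordinates. The relative
  bound and the bound for F - F^2 / L are both instances.\<close>

lemma trace_rank_one_sq_le: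
  fixes u v :: "'b \<Rightarrow> 'a::euclidean_space"
  shows "(\<Sum>k\<in>I. u k \<bullet> v k)\<^sup>2 \<le> DIM('a) * (\<Sum>k\<in>I. \<Sum>l\<in>I. (u k \<bullet> u l) * (v k \<bullet> v l))"
proof -
  have "(\<Sum>k\<in>I. u k \<bullet> v k) = (\<Sum>i\<in>Basis. \<Sum>k\<in>I. (u k \<bullet> i) * (v k \<bullet> i))"
    by (subst sum.swap) (simp add: euclidean_inner[symmetric])
  then show ?thesis
    using trace_sq_le[of "\<lambda>i j. \<Sum>k\<in>I. (u k \<bullet> i) * (v k \<bullet> j)"]
      sum_Basis_rank_one_mult[of u v I u v I]
    by (simp add: power2_eq_square)
qed

text \<open>The sum of the operators x x^T. It shares its nonzero spectrum with the Gram matrix of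
  \<open>X\<close>, and the scalar products of x with the image of y are the entries of the squared
  Gram matrix.\<close>

definition frame_op :: "'a::real_inner set \<Rightarrow> 'a \<Rightarrow> 'a" where
  "frame_op X u = (\<Sum>x\<in>X. (x \<bullet> u) *\<^sub>R x)"

lemma inner_frame_op: "v \<bullet> frame_op X u = (\<Sum>x\<in>X. (x \<bullet> v) * (x \<bullet> u))"
  by (simp add: frame_op_def inner_sum_right inner_commute mult.commute)

lemma frame_op_sym: "frame_op X u \<bullet> v = u \<bullet> frame_op X v"
  by (subst inner_commute) (simp add: inner_frame_op mult.commute)

text \<open>Schur's test: absolute row sums bound the Gram matrix, which gives
  \<open>s \<bullet> s \<le> L * q\<close>. Cauchy-Schwarz for \<open>s\<close> and \<open>u\<close>
  turns this into a bound for the quadratic form.\<close>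

lemma frame_op_bound:
  fixes X :: "'a::real_inner set"
  assumes "finite X" and L: "\<And>x. x \<in> X \<Longrightarrow> (\<Sum>y\<in>X. \<bar>x \<bullet> y\<bar>) \<le> L" and "0 < L"
  shows "frame_op X u \<bullet> u \<le> L * (u \<bullet> u)"
proof -
  define s where "s = frame_op X u"
  define q where "q = s \<bullet> u"
  have q: "q = (\<Sum>x\<in>X. (x \<bullet> u)\<^sup>2)"
    by (simp add: q_def s_def inner_commute[of _ u] inner_frame_op power2_eq_square)
  have "s \<bullet> s = (\<Sum>x\<in>X. \<Sum>y\<in>X. (x \<bullet> u) * (y \<bullet> u) * (x \<bullet> y))"
    by (simp add: s_def frame_op_def inner_sum_left inner_sum_right inner_commute mult_ac sum_distrib_left)
  also have "\<dots> \<le> (\<Sum>x\<in>X. \<Sum>y\<in>X. ((x \<bullet> u)\<^sup>2 + (y \<bullet> u)\<^sup>2) / 2 * \<bar>x \<bullet> y\<bar>)"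
  proof (intro sum_mono)
    fix x y
    have "(x \<bullet> u) * (y \<bullet> u) * (x \<bullet> y) \<le> \<bar>(x \<bullet> u) * (y \<bullet> u)\<bar> * \<bar>x \<bullet> y\<bar>"
      by (metis abs_ge_self abs_mult)
    also have "2 * \<bar>(x \<bullet> u) * (y \<bullet> u)\<bar> \<le> (x \<bullet> u)\<^sup>2 + (y \<bullet> u)\<^sup>2"
      using sum_squares_bound[of "\<bar>x \<bullet> u\<bar>" "\<bar>y \<bullet> u\<bar>"] by (simp add: abs_mult)
    then have "\<bar>(x \<bullet> u) * (y \<bullet> u)\<bar> * \<bar>x \<bullet> y\<bar> \<le> ((x \<bullet> u)\<^sup>2 + (y \<bullet> u)\<^sup>2) / 2 * \<bar>x \<bullet> y\<bar>"
      by (intro mult_right_mono) auto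
    finally show "(x \<bullet> u) * (y \<bullet> u) * (x \<bullet> y) \<le> ((x \<bullet> u)\<^sup>2 + (y \<bullet> u)\<^sup>2) / 2 * \<bar>x \<bullet> y\<bar>" .
  qed
  also have "\<dots> = (\<Sum>x\<in>X. \<Sum>y\<in>X. (x \<bullet> u)\<^sup>2 / 2 * \<bar>x \<bullet> y\<bar>) + (\<Sum>x\<in>X. \<Sum>y\<in>X. (y \<bullet> u)\<^sup>2 / 2 * \<bar>x \<bullet> y\<bar>)"
    by (simp add: add_divide_distrib distrib_right sum.distrib)
  also have "(\<Sum>x\<in>X. \<Sum>y\<in>X. (y \<bullet> u)\<^sup>2 / 2 * \<bar>x \<bullet> y\<bar>) = (\<Sum>x\<in>X. \<Sum>y\<in>X. (x \<bullet> u)\<^sup>2 / 2 * \<bar>x \<bullet> y\<bar>)"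
    by (subst sum.swap) (simp add: inner_commute)
  also have "(\<Sum>x\<in>X. \<Sum>y\<in>X. (x \<bullet> u)\<^sup>2 / 2 * \<bar>x \<bullet> y\<bar>) + (\<Sum>x\<in>X. \<Sum>y\<in>X. (x \<bullet> u)\<^sup>2 / 2 * \<bar>x \<bullet> y\<bar>)
      = (\<Sum>x\<in>X. (x \<bullet> u)\<^sup>2 * (\<Sum>y\<in>X. \<bar>x \<bullet> y\<bar>))"
    by (simp add: sum_distrib_left sum_distrib_right sum.distrib[symmetric] mult.commute)
  also have "\<dots> \<le> (\<Sum>x\<in>X. (x \<bullet> u)\<^sup>2 * L)"
    by (intro sum_mono mult_left_mono L) auto
  finally have s: "s \<bullet> s \<le> L * q"
    by (simp add: q sum_distrib_left mult.commute)
  have "q * q \<le> (s \<bullet> s) * (u \<bullet> u)"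
    using Cauchy_Schwarz_ineq[of s u] by (simp add: q_def power2_eq_square)
  also have "\<dots> \<le> L * q * (u \<bullet> u)"
    using s by (intro mult_right_mono) auto
  finally have "q * q \<le> q * (L * (u \<bullet> u))" by (simp add: mult_ac)
  moreover have "0 \<le> q" by (simp add: q sum_nonneg)
  moreover have "0 \<le> L * (u \<bullet> u)" using \<open>0 < L\<close> by simp
  ultimately have "q \<le> L * (u \<bullet> u)"
    by (cases "q = 0") auto
  then show ?thesis by (simp add: q_def s_def)
qed

text \<open>The trace inequality is applied to the operator \<open>F - F\<^sup>2 / L\<close>, where \<open>F\<close> is the frame operator;
  subtracting \<open>F\<^sup>2 / L\<close> suppresses an eigenvalue of \<open>F\<close> close to \<open>L\<close>.\<close>

lemma frame_trace_bound:
  fixes X :: "'a::euclidean_space set"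
  assumes "finite X" and L: "\<And>x. x \<in> X \<Longrightarrow> (\<Sum>y\<in>X. \<bar>x \<bullet> y\<bar>) \<le> L" and "0 < L"
  shows "((\<Sum>x\<in>X. x \<bullet> x) - (\<Sum>x\<in>X. \<Sum>y\<in>X. (x \<bullet> y)\<^sup>2) / L)\<^sup>2
     \<le> DIM('a) * ((\<Sum>x\<in>X. \<Sum>y\<in>X. (x \<bullet> y)\<^sup>2) - (\<Sum>x\<in>X. \<Sum>y\<in>X. (x \<bullet> frame_op X y)\<^sup>2) / L\<^sup>2)"
proof -
  define F where "F = frame_op X"
  define W where "W x = x - F x /\<^sub>R L" for x
  have FF: "(\<Sum>x\<in>X. (x \<bullet> u)\<^sup>2) = F u \<bullet> u" for u
    by (simp add: F_def inner_commute[of _ u] inner_frame_op power2_eq_square)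
  have FF': "(\<Sum>x\<in>X. (u \<bullet> x)\<^sup>2) = u \<bullet> F u" for u
    using FF[of u] by (simp add: inner_commute)
  have Fsym: "F u \<bullet> v = u \<bullet> F v" for u v by (simp add: F_def frame_op_sym)
  have tr: "(\<Sum>x\<in>X. x \<bullet> W x) = (\<Sum>x\<in>X. x \<bullet> x) - (\<Sum>x\<in>X. \<Sum>y\<in>X. (x \<bullet> y)\<^sup>2) / L"
    by (simp add: W_def inner_diff_right sum_subtractf FF' sum_distrib_left divide_inverse mult.commute)
  \<comment> \<open>The sum of the x (W x)^T is F - F^2 / L, so this is its squared Frobenius
    norm.\<close>
  have "(\<Sum>x\<in>X. \<Sum>y\<in>X. (x \<bullet> y) * (W x \<bullet> W y)) = (\<Sum>y\<in>X. W (F y) \<bullet> W y)"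
  proof -
    have "(\<Sum>x\<in>X. (x \<bullet> y) *\<^sub>R W x) = W (F y)" for y
    proof -
      have "F (F y) = (\<Sum>x\<in>X. (x \<bullet> y) *\<^sub>R F x)"
        unfolding F_def frame_op_def
        by (simp add: inner_sum_right scaleR_sum_left scaleR_sum_right)
          (subst sum.swap, simp add: mult.commute)
      then show ?thesis
        by (simp add: W_def scaleR_diff_right sum_subtractf scaleR_sum_right mult.commute)
          (simp add: F_def frame_op_def)
    qed
    then have "W (F y) \<bullet> W y = (\<Sum>x\<in>X. (x \<bullet> y) * (W x \<bullet> W y))" for y
      by (metis (no_types, lifting) inner_sum_left inner_scaleR_left sum.cong)
    then show ?thesis by (subst sum.swap) simp
  qed
  also have "\<dots> \<le> (\<Sum>y\<in>X. F y \<bullet> y - (F (F y) \<bullet> F y) / L\<^sup>2)"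
  proof (intro sum_mono)
    fix y
    have "W (F y) \<bullet> W y = F y \<bullet> y - 2 * (F y \<bullet> F y) / L + (F (F y) \<bullet> F y) / L\<^sup>2"
      using Fsym[of "F y" y] Fsym[of "F y" "F y"]
      by (simp add: W_def inner_diff_left inner_diff_right power2_eq_square divide_inverse algebra_simps inner_commute)
    \<comment> \<open>As quadratic forms F^3 is at most L F^2. This eliminates the F^2 term in
      favour of F^3, whose values summed over \<open>y\<close> give the trace of F^4.\<close>
    also have "F (F y) \<bullet> F y \<le> L * (F y \<bullet> F y)"
      unfolding F_def by (rule frame_op_bound) (use assms in auto)
    then have "(F (F y) \<bullet> F y) / L\<^sup>2 \<le> (F y \<bullet> F y) / L"
      using \<open>0 < L\<close> by (simp add: field_simps power2_eq_square)
    then have "F y \<bullet> y - 2 * (F y \<bullet> F y) / L + (F (F y) \<bullet> F y) / L\<^sup>2 \<le> F y \<bullet> y - (F (F y) \<bullet> F y) / L\<^sup>2"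
      by simp
    finally show "W (F y) \<bullet> W y \<le> F y \<bullet> y - (F (F y) \<bullet> F y) / L\<^sup>2" .
  qed
  also have "\<dots> = (\<Sum>x\<in>X. \<Sum>y\<in>X. (x \<bullet> y)\<^sup>2) - (\<Sum>x\<in>X. \<Sum>y\<in>X. (x \<bullet> frame_op X y)\<^sup>2) / L\<^sup>2"
    by (subst (1 2) sum.swap[of _ X X])
      (simp add: sum_subtractf sum_divide_distrib FF F_def[symmetric])
  finally have "(\<Sum>x\<in>X. \<Sum>y\<in>X. (x \<bullet> y) * (W x \<bullet> W y))
    \<le> (\<Sum>x\<in>X. \<Sum>y\<in>X. (x \<bullet> y)\<^sup>2) - (\<Sum>x\<in>X. \<Sum>y\<in>X. (x \<bullet> frame_op X y)\<^sup>2) / L\<^sup>2" .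
  then show ?thesis
    using trace_rank_one_sq_le[of "\<lambda>x. x" W X] unfolding tr
    by (smt (verit) mult_left_mono of_nat_0_le_iff)
qed

section \<open>Eigenvalues of high multiplicity\<close>

text \<open>Sylvester's determinant identity. The powers of \<open>y\<close> on both sides avoid
  inverting \<open>y\<close>, so it holds over any integral domain, in particular over polynomials.
  The determinant of one block matrix is computed twice.\<close>

lemma det_smult_one_minus_mult_swap:
  fixes U W :: "'a::idom mat"
  assumes U: "U \<in> carrier_mat N k" and W: "W \<in> carrier_mat k N"
  shows "y ^ k * det (y \<cdot>\<^sub>m 1\<^sub>m N - U * W) = y ^ N * det (y \<cdot>\<^sub>m 1\<^sub>m k - W * U)"
proof -
  let ?M = "four_block_mat (1\<^sub>m k) W U (y \<cdot>\<^sub>m 1\<^sub>m N)"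
  \<comment> \<open>Multiplying \<open>?M\<close> by \<open>?P\<close> on the right, or by
    \<open>?Q\<close> on the left, clears the upper right block and leaves one of the two Schur
    complements on the diagonal.\<close>
  let ?P = "four_block_mat (1\<^sub>m k) (- W) (0\<^sub>m N k) (1\<^sub>m N)"
  let ?Q = "four_block_mat (y \<cdot>\<^sub>m 1\<^sub>m k) (- W) (0\<^sub>m N k) (1\<^sub>m N)"
  have M: "?M \<in> carrier_mat (k + N) (k + N)" and P: "?P \<in> carrier_mat (k + N) (k + N)"
    and Q: "?Q \<in> carrier_mat (k + N) (k + N)"
    using U W by auto
  have UW: "y \<cdot>\<^sub>m 1\<^sub>m N - U * W \<in> carrier_mat N N" and WU: "y \<cdot>\<^sub>m 1\<^sub>m k - W * U \<in> carrier_mat k k"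
    using U W by (auto intro!: minus_carrier_mat mult_carrier_mat)
  have mult: "(y \<cdot>\<^sub>m 1\<^sub>m k) * W = y \<cdot>\<^sub>m W" "- W * (y \<cdot>\<^sub>m 1\<^sub>m N) = y \<cdot>\<^sub>m (- W)"
    using W by (simp_all add: mult_smult_assoc_mat[OF one_carrier_mat W] mult_smult_distrib[OF uminus_carrier_mat[OF W] one_carrier_mat])
  have "?M * ?P = four_block_mat (1\<^sub>m k) (0\<^sub>m k N) U (y \<cdot>\<^sub>m 1\<^sub>m N - U * W)"
    by (subst mult_four_block_mat[where ?n1.0=k and ?n2.0=N]) (use U W in \<open>auto intro!: eq_matI\<close>)
  then have "det ?M * det ?P = det (y \<cdot>\<^sub>m 1\<^sub>m N - U * W)"
    using det_four_block_mat_upper_right_zero[of "1\<^sub>m k" k "0\<^sub>m k N" N U "y \<cdot>\<^sub>m 1\<^sub>m N - U * W"] U UW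
    by (simp add: det_mult[OF M P, symmetric])
  moreover have "det ?P = 1"
    using det_four_block_mat_lower_left_zero[of "1\<^sub>m k" k "- W" N "0\<^sub>m N k" "1\<^sub>m N"] W by simp
  moreover have "?Q * ?M = four_block_mat (y \<cdot>\<^sub>m 1\<^sub>m k - W * U) (0\<^sub>m k N) U (y \<cdot>\<^sub>m 1\<^sub>m N)"
    by (subst mult_four_block_mat[where ?n1.0=k and ?n2.0=N]) (use U W mult in \<open>auto intro!: eq_matI\<close>)
  then have "det ?Q * det ?M = det (y \<cdot>\<^sub>m 1\<^sub>m k - W * U) * y ^ N"
    using det_four_block_mat_upper_right_zero[of "y \<cdot>\<^sub>m 1\<^sub>m k - W * U" k "0\<^sub>m k N" N U "y \<cdot>\<^sub>m 1\<^sub>m N"] U WU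
    by (simp add: det_mult[OF Q M, symmetric])
  moreover have "det ?Q = y ^ k"
    using det_four_block_mat_lower_left_zero[of "y \<cdot>\<^sub>m 1\<^sub>m k" k "- W" N "0\<^sub>m N k" "1\<^sub>m N"] W by simp
  ultimately show ?thesis by (simp add: mult.commute)
qed

text \<open>\<open>A\<close> differs from a scalar matrix by rank at most \<open>k\<close>, so
  \<open>c\<close> has multiplicity at least \<open>N - k\<close>. This is Sylvester's identity over
  the polynomial ring with y = x - c, after cancelling the k-th power of y.\<close>

lemma char_poly_dvd_of_low_rank:
  fixes A :: "'a::idom mat"
  assumes A: "A = c \<cdot>\<^sub>m 1\<^sub>m N + U * W"
    and U: "U \<in> carrier_mat N k" and W: "W \<in> carrier_mat k N" and "k \<le> N"
  shows "[:- c, 1:] ^ (N - k) dvd char_poly A"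
proof -
  let ?h = "map_mat (\<lambda>a. [:a:]) :: 'a mat \<Rightarrow> 'a poly mat"
  let ?y = "[:- c, 1:]"
  have U': "?h U \<in> carrier_mat N k" and W': "?h W \<in> carrier_mat k N" using U W by auto
  have const_sum: "(\<Sum>l\<in>I. [:f l:]) = [:\<Sum>l\<in>I. f l:]" for f :: "nat \<Rightarrow> 'a" and I
    by (induction I rule: infinite_finite_induct) auto
  have "(?h U * ?h W) $$ (i, j) = [:(U * W) $$ (i, j):]" if "i < N" "j < N" for i j
  proof -
    have "[:U $$ (i, l):] * [:W $$ (l, j):] = [:U $$ (i, l) * W $$ (l, j):]" for l
      by (simp add: mult.commute)
    then show ?thesis using U W that by (simp add: scalar_prod_def const_sum mult.commute)
  qed
  then have "char_poly_matrix A = ?y \<cdot>\<^sub>m 1\<^sub>m N - ?h U * ?h W"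
    by (intro eq_matI) (use U W in \<open>auto simp: A char_poly_matrix_def\<close>)
  then have "char_poly A = det (?y \<cdot>\<^sub>m 1\<^sub>m N - ?h U * ?h W)"
    by (simp add: char_poly_def)
  then have "?y ^ k * char_poly A = ?y ^ N * det (?y \<cdot>\<^sub>m 1\<^sub>m k - ?h W * ?h U)"
    using det_smult_one_minus_mult_swap[OF U' W', of ?y] by simp
  also have "?y ^ N = ?y ^ k * ?y ^ (N - k)"
    using \<open>k \<le> N\<close> by (simp add: power_add[symmetric])
  finally have "char_poly A = ?y ^ (N - k) * det (?y \<cdot>\<^sub>m 1\<^sub>m k - ?h W * ?h U)"
    by simp
  then show ?thesis by simp
qed

text \<open>The minimal polynomial of an irrational number over the rationals has degree at least two and
  is separable, and its multiplicity in \<open>f\<close> is the order of the root.\<close>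

lemma irrational_root_order:
  fixes f :: "rat poly" and c :: real
  assumes "c \<notin> \<rat>" and "f \<noteq> 0"
  shows "2 * order c (map_poly of_rat f) \<le> degree f"
proof (cases "poly (map_poly of_rat f) c = 0")
  case False
  then show ?thesis by (simp add: order_0I)
next
  case True
  interpret h: map_poly_inj_idom_hom "of_rat :: rat \<Rightarrow> real" ..
  define h where "h = (map_poly of_rat :: rat poly \<Rightarrow> real poly)"
  define vanishes where "vanishes p \<longleftrightarrow> p \<noteq> 0 \<and> poly (h p) c = 0" for p
  \<comment> \<open>Up to a scalar, the minimal polynomial of \<open>c\<close> over the
    rationals.\<close>
  define p where "p = arg_min degree vanishes"
  have "vanishes f" using True \<open>f \<noteq> 0\<close> by (simp add: vanishes_def h_def)
  then have p: "vanishes p" and p_min: "\<And>q. vanishes q \<Longrightarrow> degree p \<le> degree q"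
    unfolding p_def using arg_min_nat_lemma[of vanishes f degree] by auto
  have deg_p: "2 \<le> degree p"
  proof (rule ccontr)
    assume "\<not> 2 \<le> degree p"
    then have "p = [:coeff p 0, coeff p 1:]"
      by (intro poly_eqI) (auto simp: coeff_pCons coeff_eq_0 split: nat.splits)
    then obtain u v where uv: "p = [:u, v:]" by blast
    have root: "of_rat u + c * of_rat v = 0"
      using p by (simp add: vanishes_def h_def uv hom_distribs)
    have "v \<noteq> 0" using p root by (auto simp: vanishes_def uv)
    then have "c = of_rat (- u / v)"
      using root by (simp add: of_rat_divide of_rat_minus field_simps add_eq_0_iff)
    then show False using \<open>c \<notin> \<rat>\<close> by (simp add: Rats_def)
  qed
  \<comment> \<open>Separability: the derivative of \<open>p\<close> is nonzero of smaller degree,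
    so by minimality it does not vanish at \<open>c\<close>.\<close>
  have "order c (h p) = 1"
  proof -
    have "degree (pderiv p) < degree p" using deg_p by (simp add: degree_pderiv)
    moreover have "pderiv p \<noteq> 0" using deg_p by (simp add: pderiv_eq_0_iff)
    ultimately have "poly (h (pderiv p)) c \<noteq> 0"
      using p_min[of "pderiv p"] by (auto simp: vanishes_def)
    then have "poly (pderiv (h p)) c \<noteq> 0" by (simp add: h_def of_rat_hom.map_poly_pderiv)
    then show ?thesis
      using p order_pderiv[of "h p" c] by (auto simp: vanishes_def order_0I order_root h_def)
  qed
  \<comment> \<open>Splitting off a factor \<open>p\<close> lowers the order by one and the degree
    by at least two.\<close>
  have "2 * order c (h q) \<le> degree q" if "q \<noteq> 0" for q
    using that
  proof (induction "degree q" arbitrary: q rule: less_induct)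
    case less
    show ?case
    proof (cases "poly (h q) c = 0")
      case False
      then show ?thesis by (simp add: order_0I)
    next
      case True
      have "h q = h p * h (q div p) + h (q mod p)"
        unfolding h_def h.hom_mult[symmetric] h.hom_add[symmetric] by simp
      then have "poly (h (q mod p)) c = 0"
        using True p by (simp add: vanishes_def)
      have "q mod p = 0"
      proof (rule ccontr)
        assume "q mod p \<noteq> 0"
        then have "degree p \<le> degree (q mod p)"
          using p_min \<open>poly (h (q mod p)) c = 0\<close> by (simp add: vanishes_def)
        then show False
          using degree_mod_less[of p q] p \<open>q mod p \<noteq> 0\<close> by (simp add: vanishes_def)
      qed
      then obtain r where r: "q = p * r" by (metis dvdE mod_eq_0_iff_dvd)
      then have "r \<noteq> 0" "p \<noteq> 0" using less.prems by auto
      then have deg: "degree q = degree p + degree r" by (simp add: r degree_mult_eq)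
      have "order c (h q) = order c (h p) + order c (h r)"
        using less.prems by (simp add: h_def r h.hom_mult order_mult)
      then show ?thesis
        using less.hyps[of r] deg deg_p \<open>r \<noteq> 0\<close> \<open>order c (h p) = 1\<close> by simp
    qed
  qed
  then show ?thesis using \<open>f \<noteq> 0\<close> by (simp add: h_def)
qed

text \<open>A root whose multiplicity exceeds half the degree cannot be irrational, and a rational
  root of a monic integral polynomial is an integer.\<close>

lemma high_order_root_int:
  fixes f :: "int poly" and c :: real
  assumes monic: "lead_coeff f = 1" and dvd: "[:- c, 1:] ^ m dvd map_poly of_int f"
    and large: "degree f < 2 * m"
  shows "c \<in> \<int>"
proof -
  let ?f = "map_poly of_int f :: real poly"
  have "?f = map_poly of_rat (map_poly of_int f)"
    by (intro poly_eqI) (simp add: coeff_map_poly)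
  have "f \<noteq> 0" using monic by auto
  then have "m \<le> order c ?f"
    using dvd by (intro order_max) (auto simp: map_poly_eq_0_iff)
  have "c \<in> \<rat>"
  proof (rule ccontr)
    assume "c \<notin> \<rat>"
    then have "2 * order c ?f \<le> degree f"
      using irrational_root_order[of c "map_poly of_int f"] \<open>f \<noteq> 0\<close>
      unfolding \<open>?f = _\<close> by (auto simp: map_poly_eq_0_iff)
    then show False using \<open>m \<le> _\<close> large by simp
  qed
  moreover have "poly ?f c = 0"
    using \<open>m \<le> order c ?f\<close> large \<open>f \<noteq> 0\<close> by (auto simp: order_root)
  then have "algebraic_int c"
    using monic by (auto simp: algebraic_int_altdef_ipoly)
  ultimately show ?thesis by (simp add: rational_algebraic_int_is_int)
qed

section \<open>Quadratic and cubic moments\<close>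

text \<open>Projecting the matrix \<open>v w\<^sup>T + w v\<^sup>T\<close> onto the span of the matrices \<open>x x\<^sup>T\<close>.\<close>

lemma quadratic_form_bessel:
  fixes X :: "'a::euclidean_space set" and v w :: 'a and c :: "'a \<Rightarrow> real"
  shows "2 * (\<Sum>x\<in>X. c x * ((v \<bullet> x) * (w \<bullet> x))) - (\<Sum>x\<in>X. \<Sum>y\<in>X. c x * c y * (x \<bullet> y)\<^sup>2)
    \<le> ((v \<bullet> v) * (w \<bullet> w) + (v \<bullet> w)\<^sup>2) / 2"
proof -
  define C where "C i j = (\<Sum>x\<in>X. ((c x *\<^sub>R x) \<bullet> i) * (x \<bullet> j))" for i j
  define P where "P i j = (v \<bullet> i) * (w \<bullet> j)" for i j
  have P: "P i j = (\<Sum>k\<in>{()}. (v \<bullet> i) * (w \<bullet> j))"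
    and P': "P j i = (\<Sum>k\<in>{()}. (w \<bullet> i) * (v \<bullet> j))" for i j
    by (simp_all add: P_def)
  have PP: "(\<Sum>i\<in>Basis. \<Sum>j\<in>Basis. P i j * P i j) = (v \<bullet> v) * (w \<bullet> w)"
    unfolding P by (subst sum_Basis_rank_one_mult) simp
  have PP': "(\<Sum>i\<in>Basis. \<Sum>j\<in>Basis. P i j * P j i) = (v \<bullet> w)\<^sup>2"
    using sum_Basis_rank_one_mult[of "\<lambda>_. v" "\<lambda>_. w" "{()}" "\<lambda>_. w" "\<lambda>_. v" "{()}"]
    by (simp add: P_def mult.commute power2_eq_square inner_commute[of w v])
  have P'P': "(\<Sum>i\<in>Basis. \<Sum>j\<in>Basis. P j i * P j i) = (v \<bullet> v) * (w \<bullet> w)"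
    by (subst sum.swap) (rule PP)
  have PC: "(\<Sum>i\<in>Basis. \<Sum>j\<in>Basis. P i j * C i j) = (\<Sum>x\<in>X. c x * ((v \<bullet> x) * (w \<bullet> x)))"
    unfolding P C_def by (subst sum_Basis_rank_one_mult) (simp add: mult_ac)
  have P'C: "(\<Sum>i\<in>Basis. \<Sum>j\<in>Basis. P j i * C i j) = (\<Sum>x\<in>X. c x * ((v \<bullet> x) * (w \<bullet> x)))"
    unfolding P' C_def by (subst sum_Basis_rank_one_mult) (simp add: mult_ac)
  have CC: "(\<Sum>i\<in>Basis. \<Sum>j\<in>Basis. C i j * C i j) = (\<Sum>x\<in>X. \<Sum>y\<in>X. c x * c y * (x \<bullet> y)\<^sup>2)"
    unfolding C_def by (subst sum_Basis_rank_one_mult) (simp add: power2_eq_square mult_ac)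
  \<comment> \<open>The squared Frobenius distance from the symmetrised v w^T to the combination of
    the x x^T with coefficients \<open>c x\<close>.\<close>
  have "0 \<le> (\<Sum>i\<in>Basis. \<Sum>j\<in>Basis. ((P i j + P j i) / 2 - C i j)\<^sup>2)"
    by (intro sum_nonneg) auto
  also have "\<dots> = (\<Sum>i\<in>Basis. \<Sum>j\<in>Basis. (P i j * P i j) / 4 + (P j i * P j i) / 4 + (P i j * P j i) / 2
      - P i j * C i j - P j i * C i j + C i j * C i j)"
    by (intro sum.cong refl) (simp add: power2_eq_square field_simps)
  also have "\<dots> = ((v \<bullet> v) * (w \<bullet> w) + (v \<bullet> w)\<^sup>2) / 2
      - 2 * (\<Sum>x\<in>X. c x * ((v \<bullet> x) * (w \<bullet> x))) + (\<Sum>x\<in>X. \<Sum>y\<in>X. c x * c y * (x \<bullet> y)\<^sup>2)"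
    by (simp add: sum.distrib sum_subtractf sum_divide_distrib[symmetric] PP PP' P'P' PC P'C CC)
  finally show ?thesis by linarith
qed

text \<open>The trace part of the symmetric tensor \<open>T\<close>, the sum of the u (x) u (x) u,
  is no longer than \<open>T\<close> itself. For vectors of equal length this is the positivity of
  the zonal function of degree three, t^3 - 3 t / (d + 2) after normalisation.\<close>

lemma cubic_moment_bound:
  fixes u :: "'b \<Rightarrow> 'a::euclidean_space"
  shows "3 * (\<Sum>x\<in>I. \<Sum>y\<in>I. (u x \<bullet> u x) * (u y \<bullet> u y) * (u x \<bullet> u y))
    \<le> (real DIM('a) + 2) * (\<Sum>x\<in>I. \<Sum>y\<in>I. (u x \<bullet> u y) ^ 3)"
proof -
  define d where "d = real DIM('a)"
  define T where "T i j k = (\<Sum>x\<in>I. (u x \<bullet> i) * (u x \<bullet> j) * (u x \<bullet> k))" for i j k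
  define v where "v = (\<Sum>x\<in>I. (u x \<bullet> u x) *\<^sub>R u x)"
  define E where "E i j k = (i \<bullet> j) * (v \<bullet> k) + (i \<bullet> k) * (v \<bullet> j) + (j \<bullet> k) * (v \<bullet> i)" for i j k
  have basis: "(\<Sum>k\<in>Basis. (p \<bullet> k) * (q \<bullet> k)) = p \<bullet> q" for p q :: 'a
    by (rule euclidean_inner[symmetric])
  have vv: "v \<bullet> v = (\<Sum>x\<in>I. \<Sum>y\<in>I. (u x \<bullet> u x) * (u y \<bullet> u y) * (u x \<bullet> u y))"
    by (simp add: v_def inner_sum_left inner_sum_right sum_distrib_left inner_commute mult_ac)
  have TT: "(\<Sum>i\<in>Basis. \<Sum>j\<in>Basis. \<Sum>k\<in>Basis. (T i j k)\<^sup>2) = (\<Sum>x\<in>I. \<Sum>y\<in>I. (u x \<bullet> u y) ^ 3)"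
  proof -
    have "(\<Sum>i\<in>Basis. \<Sum>j\<in>Basis. \<Sum>k\<in>Basis. (T i j k)\<^sup>2)
      = (\<Sum>(i, j, k)\<in>Basis \<times> Basis \<times> Basis. \<Sum>(x, y)\<in>I \<times> I.
          ((u x \<bullet> i) * (u y \<bullet> i)) * (((u x \<bullet> j) * (u y \<bullet> j)) * ((u x \<bullet> k) * (u y \<bullet> k))))"
    proof -
      have "(T i j k)\<^sup>2 = (\<Sum>(x, y)\<in>I \<times> I.
          ((u x \<bullet> i) * (u y \<bullet> i)) * (((u x \<bullet> j) * (u y \<bullet> j)) * ((u x \<bullet> k) * (u y \<bullet> k))))" for i j k
        unfolding T_def power2_eq_square sum_product sum.cartesian_product
        by (intro sum.cong refl) (auto simp: mult_ac)
      moreover have "(\<Sum>i\<in>A. \<Sum>j\<in>A. \<Sum>k\<in>A. g i j k) = (\<Sum>(i, j, k)\<in>A \<times> A \<times> A. g i j k)"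
        for g :: "'a \<Rightarrow> 'a \<Rightarrow> 'a \<Rightarrow> real" and A
        by (simp add: sum.cartesian_product)
      ultimately show ?thesis by (simp only:)
    qed
    also have "\<dots> = (\<Sum>(x, y)\<in>I \<times> I. \<Sum>(i, j, k)\<in>Basis \<times> Basis \<times> Basis.
          ((u x \<bullet> i) * (u y \<bullet> i)) * (((u x \<bullet> j) * (u y \<bullet> j)) * ((u x \<bullet> k) * (u y \<bullet> k))))"
      unfolding case_prod_unfold by (rule sum.swap)
    also have "\<dots> = (\<Sum>(x, y)\<in>I \<times> I. (u x \<bullet> u y) ^ 3)"
    proof (intro sum.cong refl, clarify)
      fix x y
      show "(\<Sum>(i, j, k)\<in>Basis \<times> Basis \<times> Basis.
          ((u x \<bullet> i) * (u y \<bullet> i)) * (((u x \<bullet> j) * (u y \<bullet> j)) * ((u x \<bullet> k) * (u y \<bullet> k)))) = (u x \<bullet> u y) ^ 3"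
        by (simp only: sum.cartesian_product[symmetric] sum_distrib_left[symmetric]
          sum_distrib_right[symmetric] basis) (simp add: power3_eq_cube)
    qed
    finally show ?thesis by (simp add: sum.cartesian_product)
  qed
  have trace: "(\<Sum>i\<in>Basis. T i i k) = v \<bullet> k" for k
  proof -
    have "(\<Sum>i\<in>Basis. T i i k) = (\<Sum>x\<in>I. (\<Sum>i\<in>Basis. (u x \<bullet> i) * (u x \<bullet> i)) * (u x \<bullet> k))"
      unfolding T_def sum_distrib_right by (rule sum.swap)
    then show ?thesis by (simp add: basis v_def inner_sum_left)
  qed
  have T_sym: "T i j k = T j i k" "T i j k = T i k j" for i j k
    by (simp_all add: T_def mult_ac)
  have delta: "(\<Sum>j\<in>Basis. (i \<bullet> j) * g j) = g i" if "i \<in> Basis" for i :: 'a and g :: "'a \<Rightarrow> real"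
    using that by (simp add: inner_Basis if_distrib[of "\<lambda>x. x * _"] cong: if_cong)
  have TE: "(\<Sum>i\<in>Basis. \<Sum>j\<in>Basis. \<Sum>k\<in>Basis. T i j k * E i j k) = 3 * (v \<bullet> v)"
  proof -
    have 1: "(\<Sum>i\<in>Basis. \<Sum>j\<in>Basis. \<Sum>k\<in>Basis. (i \<bullet> j) * ((v \<bullet> k) * T i j k)) = v \<bullet> v"
    proof -
      have "(\<Sum>i\<in>Basis. \<Sum>j\<in>Basis. \<Sum>k\<in>Basis. (i \<bullet> j) * ((v \<bullet> k) * T i j k))
        = (\<Sum>i\<in>Basis. \<Sum>k\<in>Basis. (v \<bullet> k) * T i i k)"
        by (simp add: sum_distrib_left[symmetric] delta)
      also have "\<dots> = (\<Sum>k\<in>Basis. (v \<bullet> k) * (\<Sum>i\<in>Basis. T i i k))"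
        by (subst sum.swap) (simp add: sum_distrib_left)
      finally show ?thesis by (simp add: trace basis)
    qed
    have "(\<Sum>i\<in>Basis. \<Sum>j\<in>Basis. \<Sum>k\<in>Basis. (i \<bullet> k) * ((v \<bullet> j) * T i j k))
      = (\<Sum>i\<in>Basis. \<Sum>k\<in>Basis. \<Sum>j\<in>Basis. (i \<bullet> k) * ((v \<bullet> j) * T i k j))"
      by (rule sum.cong[OF refl], subst sum.swap) (intro sum.cong refl arg_cong2[where f="(*)"] T_sym(2))
    also have "\<dots> = v \<bullet> v" by (rule 1)
    finally have 2: "(\<Sum>i\<in>Basis. \<Sum>j\<in>Basis. \<Sum>k\<in>Basis. (i \<bullet> k) * ((v \<bullet> j) * T i j k)) = v \<bullet> v" .
    have "(\<Sum>i\<in>Basis. \<Sum>j\<in>Basis. \<Sum>k\<in>Basis. (j \<bullet> k) * ((v \<bullet> i) * T i j k))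
      = (\<Sum>j\<in>Basis. \<Sum>i\<in>Basis. \<Sum>k\<in>Basis. (j \<bullet> k) * ((v \<bullet> i) * T j i k))"
      by (subst sum.swap) (intro sum.cong refl arg_cong2[where f="(*)"] T_sym(1))
    also have "\<dots> = v \<bullet> v" by (rule 2)
    finally have 3: "(\<Sum>i\<in>Basis. \<Sum>j\<in>Basis. \<Sum>k\<in>Basis. (j \<bullet> k) * ((v \<bullet> i) * T i j k)) = v \<bullet> v" .
    show ?thesis
    proof -
      have "T i j k * E i j k = (i \<bullet> j) * ((v \<bullet> k) * T i j k) + (i \<bullet> k) * ((v \<bullet> j) * T i j k)
          + (j \<bullet> k) * ((v \<bullet> i) * T i j k)" for i j k
        by (simp add: E_def algebra_simps)
      then show ?thesis using 1 2 3 by (simp add: sum.distrib)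
    qed
  qed
  have EE: "(\<Sum>i\<in>Basis. \<Sum>j\<in>Basis. \<Sum>k\<in>Basis. E i j k * E i j k) = (3 * d + 6) * (v \<bullet> v)"
  proof -
    have "(\<Sum>k\<in>Basis. E i j k * E i j k) = (i \<bullet> j) * ((v \<bullet> v) + 4 * (v \<bullet> i) * (v \<bullet> j)) + (v \<bullet> i)\<^sup>2 + (v \<bullet> j)\<^sup>2
        + (i \<bullet> j) * (2 * (v \<bullet> i) * (v \<bullet> j))"
      if "i \<in> Basis" "j \<in> Basis" for i j
    proof -
      have "E i j k * E i j k = (i \<bullet> j) * (i \<bullet> j) * ((v \<bullet> k) * (v \<bullet> k)) + (v \<bullet> j)\<^sup>2 * ((i \<bullet> k) * (i \<bullet> k)) + (v \<bullet> i)\<^sup>2 * ((j \<bullet> k) * (j \<bullet> k))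
        + 2 * (i \<bullet> j) * (v \<bullet> j) * ((v \<bullet> k) * (i \<bullet> k)) + 2 * (i \<bullet> j) * (v \<bullet> i) * ((v \<bullet> k) * (j \<bullet> k)) + 2 * (v \<bullet> i) * (v \<bullet> j) * ((i \<bullet> k) * (j \<bullet> k))" for k
        by (simp add: E_def power2_eq_square algebra_simps)
      then show ?thesis
        using that by (simp add: sum.distrib sum_distrib_left[symmetric] basis)
          (simp add: inner_Basis algebra_simps)
    qed
    then have "(\<Sum>i\<in>Basis. \<Sum>j\<in>Basis. \<Sum>k\<in>Basis. E i j k * E i j k)
      = (\<Sum>i\<in>Basis. \<Sum>j\<in>Basis. (i \<bullet> j) * ((v \<bullet> v) + 6 * (v \<bullet> i) * (v \<bullet> j)) + (v \<bullet> i) * (v \<bullet> i) + (v \<bullet> j) * (v \<bullet> j))"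
      by (simp add: algebra_simps power2_eq_square)
    also have "\<dots> = (\<Sum>i\<in>Basis. (v \<bullet> v) + 6 * (v \<bullet> i) * (v \<bullet> i) + d * ((v \<bullet> i) * (v \<bullet> i)) + v \<bullet> v)"
      by (intro sum.cong refl) (simp add: sum.distrib delta basis d_def)
    also have "\<dots> = (3 * d + 6) * (v \<bullet> v)"
      by (simp add: sum.distrib sum_distrib_left[symmetric] basis d_def mult.assoc) (simp add: algebra_simps)
    finally show ?thesis .
  qed
  \<comment> \<open>Contracting \<open>T\<close> gives \<open>v\<close> and contracting
    \<open>E\<close> gives (d + 2) v, so this difference is d + 2 times the traceless part of
    \<open>T\<close>.\<close>
  have "0 \<le> (\<Sum>i\<in>Basis. \<Sum>j\<in>Basis. \<Sum>k\<in>Basis. ((d + 2) * T i j k - E i j k)\<^sup>2)"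
    by (intro sum_nonneg) auto
  also have "\<dots> = (\<Sum>i\<in>Basis. \<Sum>j\<in>Basis. \<Sum>k\<in>Basis.
      (d + 2)\<^sup>2 * (T i j k)\<^sup>2 - 2 * (d + 2) * (T i j k * E i j k) + E i j k * E i j k)"
    by (intro sum.cong refl) (simp add: power2_eq_square algebra_simps)
  also have "\<dots> = (d + 2)\<^sup>2 * (\<Sum>x\<in>I. \<Sum>y\<in>I. (u x \<bullet> u y) ^ 3) - 2 * (d + 2) * (3 * (v \<bullet> v)) + (3 * d + 6) * (v \<bullet> v)"
    by (simp only: sum.distrib sum_subtractf sum_distrib_left[symmetric] TT TE EE)
  also have "\<dots> = (d + 2) * ((d + 2) * (\<Sum>x\<in>I. \<Sum>y\<in>I. (u x \<bullet> u y) ^ 3) - 3 * (v \<bullet> v))"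
    by (simp add: power2_eq_square algebra_simps)
  finally have "3 * (v \<bullet> v) \<le> (d + 2) * (\<Sum>x\<in>I. \<Sum>y\<in>I. (u x \<bullet> u y) ^ 3)"
    by (simp add: zero_le_mult_iff d_def)
  then show ?thesis by (simp add: vv d_def add.commute)
qed

section \<open>Equiangular sets\<close>

locale equiangular =
  fixes X :: "'a::euclidean_space set" and \<alpha> :: real
  assumes fin: "finite X"
    and unit: "x \<in> X \<Longrightarrow> x \<bullet> x = 1"
    and angle: "x \<in> X \<Longrightarrow> y \<in> X \<Longrightarrow> x \<noteq> y \<Longrightarrow> x \<bullet> y = \<alpha> \<or> x \<bullet> y = - \<alpha>"
    and \<alpha>: "0 \<le> \<alpha>" "\<alpha> < 1"
begin

abbreviation "N \<equiv> real (card X)"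

lemma angle_sq: "x \<in> X \<Longrightarrow> y \<in> X \<Longrightarrow> x \<noteq> y \<Longrightarrow> (x \<bullet> y)\<^sup>2 = \<alpha>\<^sup>2"
  using angle by fastforce

lemma sum_split_off:
  fixes f :: "'a \<Rightarrow> real"
  assumes "x \<in> X" and "\<And>y. y \<in> X \<Longrightarrow> y \<noteq> x \<Longrightarrow> f y = c"
  shows "sum f X = f x + (N - 1) * c"
proof -
  have "sum f X = f x + sum f (X - {x})"
    using fin \<open>x \<in> X\<close> by (rule sum.remove)
  also have "sum f (X - {x}) = (\<Sum>y\<in>X - {x}. c)"
    using assms(2) by (intro sum.cong) auto
  also have "\<dots> = (N - 1) * c"
    using fin \<open>x \<in> X\<close> card_gt_0_iff[of X] by (auto simp: card_Diff_singleton of_nat_diff)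
  finally show ?thesis .
qed

lemma sum_inner_sq:
  assumes "x \<in> X"
  shows "(\<Sum>y\<in>X. (x \<bullet> y)\<^sup>2) = 1 + (N - 1) * \<alpha>\<^sup>2"
  using sum_split_off[OF assms, of "\<lambda>y. (x \<bullet> y)\<^sup>2" "\<alpha>\<^sup>2"] angle_sq[OF assms] unit[OF assms] by auto

text \<open>The trace inequality for the frame operator, whose trace is \<open>N\<close>. The
  product form also makes sense when the factor of \<open>N\<close> is not positive.\<close>

lemma relative_bound: "N * (1 - DIM('a) * \<alpha>\<^sup>2) \<le> DIM('a) * (1 - \<alpha>\<^sup>2)"
proof (cases "X = {}")
  case True
  then show ?thesis using \<alpha> by (simp add: power_le_one)
next
  case False
  then have "0 < N" using fin by (simp add: card_gt_0_iff)
  have "N\<^sup>2 \<le> DIM('a) * (N * (1 + (N - 1) * \<alpha>\<^sup>2))"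
    using trace_rank_one_sq_le[of "\<lambda>x. x" "\<lambda>x. x" X]
    by (simp add: unit sum_inner_sq power2_eq_square[symmetric])
  then have "N * N \<le> N * (DIM('a) * (1 + (N - 1) * \<alpha>\<^sup>2))"
    by (simp add: power2_eq_square mult_ac)
  then have "N \<le> DIM('a) * (1 + (N - 1) * \<alpha>\<^sup>2)" using \<open>0 < N\<close> by simp
  then show ?thesis by (simp add: algebra_simps)
qed

text \<open>The numbers \<open>f x\<close> are the scalar products of the symmetrised v w^T with the
  x x^T. The projection inequality bounds their variance, and since the sum of their squares is
  known, their sum \<open>s\<close> must be large in modulus.\<close>

lemma inner_frame_op_sq_ge_distinct:
  assumes v: "v \<in> X" and w: "w \<in> X" and "v \<noteq> w"
  shows "N * ((N - 2) * \<alpha> ^ 4 + 2 * \<alpha>\<^sup>2 - (1 - \<alpha> ^ 4) / 2) \<le> (v \<bullet> frame_op X w)\<^sup>2"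
proof -
  define f where "f x = (v \<bullet> x) * (w \<bullet> x)" for x
  define s where "s = v \<bullet> frame_op X w"
  have s: "s = sum f X" by (simp add: s_def f_def inner_frame_op inner_commute)
  have "0 < N" using fin v by (auto simp: card_gt_0_iff)
  have r: "0 < 1 - \<alpha>\<^sup>2" using \<alpha> by (simp add: power_less_one_iff abs_square_less_1)
  \<comment> \<open>The x x^T have Gram matrix (1 - \<alpha>^2) I + \<alpha>^2 J with J all ones, so
    on coefficients of sum zero it acts as a scalar, and these coefficients are optimal among
    them.\<close>
  define c where "c x = (f x - s / N) / (1 - \<alpha>\<^sup>2)" for x
  have c0: "sum c X = 0"
    using \<open>0 < N\<close> by (simp add: c_def s sum_divide_distrib[symmetric] sum_subtractf)
  define Q where "Q = (\<Sum>x\<in>X. (f x)\<^sup>2)"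
  \<comment> \<open>The points \<open>v\<close> and \<open>w\<close> contribute \<alpha>^2 each, all
    others \<alpha>^4.\<close>
  have Q: "Q = (N - 2) * \<alpha> ^ 4 + 2 * \<alpha>\<^sup>2"
  proof -
    have "Q = (f v)\<^sup>2 + ((f w)\<^sup>2 + sum (\<lambda>x. (f x)\<^sup>2) (X - {v} - {w}))"
      unfolding Q_def using fin v w \<open>v \<noteq> w\<close>
      by (subst sum.remove[of X v], simp, simp, subst sum.remove[of "X - {v}" w]) auto
    also have "sum (\<lambda>x. (f x)\<^sup>2) (X - {v} - {w}) = (\<Sum>x\<in>X - {v} - {w}. \<alpha> ^ 4)"
      using v w by (intro sum.cong refl) (auto simp: f_def power_mult_distrib angle_sq)
    also have "\<dots> = (N - 2) * \<alpha> ^ 4"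
    proof -
      have "card {v, w} \<le> card X" using fin v w by (intro card_mono) auto
      then have "real (card (X - {v} - {w})) = N - 2"
        using fin v w \<open>v \<noteq> w\<close> by (simp add: card_Diff_singleton of_nat_diff)
      then show ?thesis by simp
    qed
    finally show ?thesis
      using v w \<open>v \<noteq> w\<close> by (simp add: f_def unit power_mult_distrib angle_sq)
  qed
  have cf: "(\<Sum>x\<in>X. c x * f x) = (Q - s\<^sup>2 / N) / (1 - \<alpha>\<^sup>2)"
  proof -
    have "(\<Sum>x\<in>X. c x * f x) = (\<Sum>x\<in>X. (f x)\<^sup>2 - s / N * f x) / (1 - \<alpha>\<^sup>2)"
      unfolding sum_divide_distrib by (intro sum.cong refl) (simp add: c_def power2_eq_square left_diff_distrib)
    also have "(\<Sum>x\<in>X. (f x)\<^sup>2 - s / N * f x) = Q - s / N * s"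
      by (simp only: sum_subtractf Q_def sum_distrib_left[symmetric] s[symmetric])
    finally show ?thesis by (simp add: power2_eq_square)
  qed
  have "(\<Sum>x\<in>X. \<Sum>y\<in>X. c x * c y * (x \<bullet> y)\<^sup>2) = (\<Sum>x\<in>X. c x * f x - c x * (s / N))"
  proof (intro sum.cong refl)
    fix x assume x: "x \<in> X"
    have "(\<Sum>y\<in>X. c y * (x \<bullet> y)\<^sup>2) = c x + (\<Sum>y\<in>X - {x}. c y * (x \<bullet> y)\<^sup>2)"
      using sum.remove[OF fin x, of "\<lambda>y. c y * (x \<bullet> y)\<^sup>2"] unit[OF x] by simp
    also have "(\<Sum>y\<in>X - {x}. c y * (x \<bullet> y)\<^sup>2) = (\<Sum>y\<in>X - {x}. c y) * \<alpha>\<^sup>2"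
      unfolding sum_distrib_right using x by (intro sum.cong refl) (auto simp: angle_sq)
    also have "(\<Sum>y\<in>X - {x}. c y) = - c x"
      using sum.remove[OF fin x, of c] c0 by simp
    finally have "(\<Sum>y\<in>X. c y * (x \<bullet> y)\<^sup>2) = c x * (1 - \<alpha>\<^sup>2)" by (simp add: algebra_simps)
    also have "\<dots> = f x - s / N" using r by (simp add: c_def)
    finally show "(\<Sum>y\<in>X. c x * c y * (x \<bullet> y)\<^sup>2) = c x * f x - c x * (s / N)"
      by (simp add: mult.assoc sum_distrib_left[symmetric] right_diff_distrib)
  qed
  also have "\<dots> = (\<Sum>x\<in>X. c x * f x)"
    using c0 by (simp only: sum_subtractf sum_distrib_right[symmetric])
  finally have cc: "(\<Sum>x\<in>X. \<Sum>y\<in>X. c x * c y * (x \<bullet> y)\<^sup>2) = (\<Sum>x\<in>X. c x * f x)" .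
  have "2 * (\<Sum>x\<in>X. c x * f x) - (\<Sum>x\<in>X. c x * f x) \<le> ((v \<bullet> v) * (w \<bullet> w) + (v \<bullet> w)\<^sup>2) / 2"
    using quadratic_form_bessel[where X = X and c = c and v = v and w = w]
    unfolding cc f_def[symmetric] .
  then have "(\<Sum>x\<in>X. c x * f x) \<le> (1 + \<alpha>\<^sup>2) / 2"
    using v w \<open>v \<noteq> w\<close> by (simp add: unit angle_sq)
  then have "(Q - s\<^sup>2 / N) / (1 - \<alpha>\<^sup>2) \<le> (1 + \<alpha>\<^sup>2) / 2"
    unfolding cf .
  then have "Q - s\<^sup>2 / N \<le> (1 + \<alpha>\<^sup>2) / 2 * (1 - \<alpha>\<^sup>2)"
    using r by (simp add: pos_divide_le_eq)
  also have "\<dots> = (1 - \<alpha> ^ 4) / 2" by (simp add: algebra_simps power2_eq_square power4_eq_xxxx)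
  finally have "Q - (1 - \<alpha> ^ 4) / 2 \<le> s\<^sup>2 / N" by linarith
  then have "N * (Q - (1 - \<alpha> ^ 4) / 2) \<le> s\<^sup>2"
    using \<open>0 < N\<close> by (simp add: field_simps)
  then show ?thesis by (simp add: Q s_def)
qed

text \<open>A weaker estimate that also covers the diagonal, so that it can be summed over all
  pairs.\<close>

lemma inner_frame_op_sq_ge:
  assumes v: "v \<in> X" and w: "w \<in> X"
  shows "N * (N * \<alpha> ^ 4 - 1 / 2) \<le> (v \<bullet> frame_op X w)\<^sup>2"
proof (cases "v = w")
  case True
  have "v \<bullet> frame_op X w = 1 - \<alpha>\<^sup>2 + N * \<alpha>\<^sup>2"
    using sum_inner_sq[OF v] by (simp add: True inner_frame_op power2_eq_square inner_commute algebra_simps)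
  then have "(N * \<alpha>\<^sup>2)\<^sup>2 \<le> (v \<bullet> frame_op X w)\<^sup>2"
    using \<alpha> by (auto intro!: power_mono simp: power_le_one)
  moreover have "N * (N * \<alpha> ^ 4 - 1 / 2) \<le> (N * \<alpha>\<^sup>2)\<^sup>2"
    by (simp add: power2_eq_square power4_eq_xxxx algebra_simps)
  ultimately show ?thesis by linarith
next
  case False
  have "\<alpha> ^ 4 \<le> \<alpha>\<^sup>2" using \<alpha> by (intro power_decreasing) auto
  then have "2 * \<alpha> ^ 4 + (1 - \<alpha> ^ 4) / 2 \<le> 1 / 2 + 2 * \<alpha>\<^sup>2"
    using zero_le_power2[of \<alpha>] unfolding diff_divide_distrib by linarith
  then have "N * \<alpha> ^ 4 - 1 / 2 \<le> (N - 2) * \<alpha> ^ 4 + 2 * \<alpha>\<^sup>2 - (1 - \<alpha> ^ 4) / 2"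
    unfolding left_diff_distrib by linarith
  then have "N * (N * \<alpha> ^ 4 - 1 / 2) \<le> N * ((N - 2) * \<alpha> ^ 4 + 2 * \<alpha>\<^sup>2 - (1 - \<alpha> ^ 4) / 2)"
    by (intro mult_left_mono) auto
  also have "\<dots> \<le> (v \<bullet> frame_op X w)\<^sup>2"
    using v w False by (rule inner_frame_op_sq_ge_distinct)
  finally show ?thesis .
qed

text \<open>The inequality for F - F^2 / L with \<open>L\<close> the common absolute row sum of the
  Gram matrix, multiplied by L^2. The last term bounds the trace of F^4 from below entry by
  entry.\<close>

lemma trace_bound:
  assumes "X \<noteq> {}"
  shows "N\<^sup>2 * (N - 1)\<^sup>2 * \<alpha>\<^sup>2 * (1 - \<alpha>)\<^sup>2
    \<le> DIM('a) * (N * (1 + (N - 1) * \<alpha>\<^sup>2) * (1 + (N - 1) * \<alpha>)\<^sup>2 - N ^ 3 * (N * \<alpha> ^ 4 - 1 / 2))"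
proof -
  define L where "L = 1 + (N - 1) * \<alpha>"
  have "1 \<le> N" using assms fin by (simp add: Suc_le_eq card_gt_0_iff)
  then have "0 < L" using \<alpha> by (simp add: L_def add_pos_nonneg)
  have row: "(\<Sum>y\<in>X. \<bar>x \<bullet> y\<bar>) \<le> L" if "x \<in> X" for x
    using sum_split_off[OF that, of "\<lambda>y. \<bar>x \<bullet> y\<bar>" \<alpha>] angle[OF that] unit[OF that] \<alpha>
    by (force simp: L_def)
  have "N ^ 3 * (N * \<alpha> ^ 4 - 1 / 2) = (\<Sum>x\<in>X. \<Sum>y\<in>X. N * (N * \<alpha> ^ 4 - 1 / 2))"
    by (simp add: power3_eq_cube)
  also have "\<dots> \<le> (\<Sum>x\<in>X. \<Sum>y\<in>X. (x \<bullet> frame_op X y)\<^sup>2)"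
    by (intro sum_mono inner_frame_op_sq_ge)
  finally have F: "N ^ 3 * (N * \<alpha> ^ 4 - 1 / 2) \<le> (\<Sum>x\<in>X. \<Sum>y\<in>X. (x \<bullet> frame_op X y)\<^sup>2)" .
  have G: "(\<Sum>x\<in>X. \<Sum>y\<in>X. (x \<bullet> y)\<^sup>2) = N * (1 + (N - 1) * \<alpha>\<^sup>2)"
    by (simp add: sum_inner_sq)
  have "(N - N * (1 + (N - 1) * \<alpha>\<^sup>2) / L)\<^sup>2
      \<le> DIM('a) * (N * (1 + (N - 1) * \<alpha>\<^sup>2) - (\<Sum>x\<in>X. \<Sum>y\<in>X. (x \<bullet> frame_op X y)\<^sup>2) / L\<^sup>2)"
    using frame_trace_bound[OF fin row \<open>0 < L\<close>] by (simp add: G unit)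
  also have "\<dots> \<le> DIM('a) * (N * (1 + (N - 1) * \<alpha>\<^sup>2) - N ^ 3 * (N * \<alpha> ^ 4 - 1 / 2) / L\<^sup>2)"
    by (intro mult_left_mono diff_left_mono divide_right_mono F) auto
  finally have "(N - N * (1 + (N - 1) * \<alpha>\<^sup>2) / L)\<^sup>2 * L\<^sup>2
      \<le> DIM('a) * (N * (1 + (N - 1) * \<alpha>\<^sup>2) - N ^ 3 * (N * \<alpha> ^ 4 - 1 / 2) / L\<^sup>2) * L\<^sup>2"
    by (rule mult_right_mono) simp
  moreover have "(N - N * (1 + (N - 1) * \<alpha>\<^sup>2) / L)\<^sup>2 * L\<^sup>2 = (N * (L - (1 + (N - 1) * \<alpha>\<^sup>2)))\<^sup>2"
    using \<open>0 < L\<close> by (simp add: power_mult_distrib[symmetric] left_diff_distrib right_diff_distrib)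
  moreover have "L - (1 + (N - 1) * \<alpha>\<^sup>2) = (N - 1) * \<alpha> * (1 - \<alpha>)"
    by (simp add: L_def power2_eq_square algebra_simps)
  moreover have "DIM('a) * (N * (1 + (N - 1) * \<alpha>\<^sup>2) - N ^ 3 * (N * \<alpha> ^ 4 - 1 / 2) / L\<^sup>2) * L\<^sup>2
      = DIM('a) * (N * (1 + (N - 1) * \<alpha>\<^sup>2) * L\<^sup>2 - N ^ 3 * (N * \<alpha> ^ 4 - 1 / 2))"
  proof -
    have "(p - q / L\<^sup>2) * L\<^sup>2 = p * L\<^sup>2 - q" for p q
      using \<open>0 < L\<close> by (simp add: left_diff_distrib)
    then show ?thesis by (simp only: mult.assoc)
  qed
  ultimately show ?thesis
    by (simp add: power_mult_distrib L_def mult.assoc)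
qed

text \<open>The constant \<open>\<alpha>\<^sup>2 + 3 \<alpha>\<^sup>4\<close> is chosen so that \<open>t\<^sup>3 - (\<alpha>\<^sup>2 + 3 \<alpha>\<^sup>4) t\<close> takes the same value at the two
  possible inner products \<open>\<alpha> - \<alpha>\<^sup>2\<close> and \<open>- \<alpha> - \<alpha>\<^sup>2\<close> of the vectors projected along \<open>x\<^sub>0\<close>.\<close>

lemma small_dimension_bound:
  assumes "2 \<le> card X" and dim: "(real DIM('a) + 2) * (\<alpha>\<^sup>2 + 3 * \<alpha> ^ 4) \<le> 3 * (1 - \<alpha>\<^sup>2)\<^sup>2"
  shows "2 * N * \<alpha> ^ 4 \<le> (1 - \<alpha>\<^sup>2) * (1 - 2 * \<alpha>\<^sup>2)"
proof -
  obtain x\<^sub>0 where x0: "x\<^sub>0 \<in> X" using \<open>2 \<le> card X\<close> by fastforce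
  define Y where "Y = X - {x\<^sub>0}"
  define m where "m = N - 1"
  have finY: "finite Y" and cardY: "real (card Y) = m"
    using fin x0 \<open>2 \<le> card X\<close> by (simp_all add: Y_def m_def card_Diff_singleton of_nat_diff)
  have "1 \<le> m" using \<open>2 \<le> card X\<close> by (simp add: m_def)
  define r where "r = 1 - \<alpha>\<^sup>2"
  define c where "c = \<alpha>\<^sup>2 + 3 * \<alpha> ^ 4"
  have "0 < r" using \<alpha> by (simp add: r_def power_less_one_iff abs_square_less_1)
  \<comment> \<open>Replacing points by their negatives makes every inner product with
    \<open>x\<^sub>0\<close> equal to \<open>\<alpha>\<close>; then \<open>u y\<close> is the
    component orthogonal to \<open>x\<^sub>0\<close>.\<close>
  define sg :: "'a \<Rightarrow> real" where "sg y = (if x\<^sub>0 \<bullet> y = \<alpha> then 1 else - 1)" for y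
  define u where "u y = sg y *\<^sub>R y - \<alpha> *\<^sub>R x\<^sub>0" for y
  have sg: "sg y * (x\<^sub>0 \<bullet> y) = \<alpha>" if "y \<in> Y" for y
    using that angle[OF x0, of y] by (auto simp: sg_def Y_def)
  have sgsq: "sg y * sg y = 1" for y by (simp add: sg_def)
  have uu: "u y \<bullet> u z = sg y * sg z * (y \<bullet> z) - \<alpha>\<^sup>2" if "y \<in> Y" "z \<in> Y" for y z
    using sg[OF that(1)] sg[OF that(2)] unit[OF x0]
    by (simp add: u_def inner_diff_left inner_diff_right inner_commute power2_eq_square algebra_simps)
  have diag: "u y \<bullet> u y = r" if "y \<in> Y" for y
    using uu[OF that that] that unit[of y] by (simp add: sgsq r_def Y_def)
  define t where "t y z = u y \<bullet> u z" for y z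
  have off_diag: "t y z ^ 3 - c * t y z = - 2 * \<alpha> ^ 4 * r" if "y \<in> Y" "z \<in> Y" "y \<noteq> z" for y z
  proof -
    have "t y z = \<alpha> - \<alpha>\<^sup>2 \<or> t y z = - \<alpha> - \<alpha>\<^sup>2"
      using uu[OF that(1,2)] angle[of y z] that by (auto simp: t_def sg_def Y_def)
    then show ?thesis
    proof
      assume t: "t y z = \<alpha> - \<alpha>\<^sup>2"
      show ?thesis unfolding t c_def r_def
        by (simp add: power2_eq_square power3_eq_cube power4_eq_xxxx algebra_simps)
    next
      assume t: "t y z = - \<alpha> - \<alpha>\<^sup>2"
      show ?thesis unfolding t c_def r_def
        by (simp add: power2_eq_square power3_eq_cube power4_eq_xxxx algebra_simps)
    qed
  qed
  define S where "S = (\<Sum>y\<in>Y. \<Sum>z\<in>Y. t y z)"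
  define S3 where "S3 = (\<Sum>y\<in>Y. \<Sum>z\<in>Y. t y z ^ 3)"
  have "S = (\<Sum>y\<in>Y. u y) \<bullet> (\<Sum>y\<in>Y. u y)"
    unfolding S_def t_def inner_sum_left inner_sum_right by (rule sum.swap)
  then have "0 \<le> S" by simp
  have "3 * (r\<^sup>2 * S) \<le> (real DIM('a) + 2) * S3"
  proof -
    have "(\<Sum>y\<in>Y. \<Sum>z\<in>Y. (u y \<bullet> u y) * (u z \<bullet> u z) * (u y \<bullet> u z)) = r\<^sup>2 * S"
      by (simp add: S_def sum_distrib_left diag t_def power2_eq_square)
    then show ?thesis using cubic_moment_bound[of u Y] by (simp add: S3_def t_def)
  qed
  \<comment> \<open>By the assumption on the dimension, \<open>c\<close> is at most the cubic
    constant 3 r^2 / (d + 2), where d is the dimension. Passing to \<open>c\<close> is allowed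
    because \<open>S\<close>, the moment of degree one, is nonnegative.\<close>
  moreover have "(real DIM('a) + 2) * c * S \<le> 3 * r\<^sup>2 * S"
    using dim \<open>0 \<le> S\<close> by (intro mult_right_mono) (auto simp: c_def r_def)
  ultimately have "(real DIM('a) + 2) * (c * S) \<le> (real DIM('a) + 2) * S3"
    unfolding mult.assoc by (rule order_trans[rotated])
  then have "0 \<le> S3 - c * S" by simp
  also have "S3 - c * S = (\<Sum>y\<in>Y. \<Sum>z\<in>Y. t y z ^ 3 - c * t y z)"
    by (simp add: S3_def S_def sum_subtractf sum_distrib_left)
  also have "\<dots> = (\<Sum>y\<in>Y. (r ^ 3 - c * r) + (m - 1) * (- 2 * \<alpha> ^ 4 * r))"
  proof (intro sum.cong refl)
    fix y assume y: "y \<in> Y"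
    have "(\<Sum>z\<in>Y. t y z ^ 3 - c * t y z) = (t y y ^ 3 - c * t y y) + (\<Sum>z\<in>Y - {y}. t y z ^ 3 - c * t y z)"
      using finY y by (rule sum.remove)
    also have "(\<Sum>z\<in>Y - {y}. t y z ^ 3 - c * t y z) = (\<Sum>z\<in>Y - {y}. - 2 * \<alpha> ^ 4 * r)"
      using y by (intro sum.cong refl off_diag) auto
    also have "\<dots> = (m - 1) * (- 2 * \<alpha> ^ 4 * r)"
    proof -
      have "real (card (Y - {y})) = m - 1"
        using finY y \<open>1 \<le> m\<close> by (simp add: cardY[symmetric] card_Diff_singleton of_nat_diff)
      then show ?thesis by simp
    qed
    finally show "(\<Sum>z\<in>Y. t y z ^ 3 - c * t y z) = (r ^ 3 - c * r) + (m - 1) * (- 2 * \<alpha> ^ 4 * r)"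
      by (simp add: t_def diag[OF y])
  qed
  also have "\<dots> = (m * r) * (r\<^sup>2 - c - 2 * (m - 1) * \<alpha> ^ 4)"
    by (simp add: cardY power2_eq_square power3_eq_cube algebra_simps)
  finally have "(m * r) * 0 \<le> (m * r) * (r\<^sup>2 - c - 2 * (m - 1) * \<alpha> ^ 4)" by simp
  moreover have "0 < m * r" using \<open>0 < r\<close> \<open>1 \<le> m\<close> by simp
  ultimately have "0 \<le> r\<^sup>2 - c - 2 * (m - 1) * \<alpha> ^ 4" by (simp only: mult_le_cancel_left_pos)
  then show ?thesis
    by (simp add: r_def c_def m_def power2_eq_square power4_eq_xxxx algebra_simps)
qed

text \<open>The eigenvalue \<open>(1/\<alpha> - 1)/2\<close> of the integral matrix \<open>A\<close> marking the pairs with inner product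
  \<open>- \<alpha>\<close> has multiplicity at least \<open>N - n - 1\<close>.\<close>

lemma inverse_angle_odd:
  assumes "0 < \<alpha>" and large: "2 * DIM('a) + 2 < card X"
  shows "(1 / \<alpha> - 1) / 2 \<in> \<int>"
proof -
  define b where "b = 1 / \<alpha>"
  define n where "n = card X"
  define d where "d = DIM('a)"
  obtain e where e: "bij_betw e {0..<n} X"
    using ex_bij_betw_nat_finite[OF fin] unfolding n_def by blast
  obtain g where g: "bij_betw g {0..<d} (Basis :: 'a set)"
    using ex_bij_betw_nat_finite[OF finite_Basis] unfolding d_def by blast
  have eX: "e i \<in> X" if "i < n" for i using e that by (auto simp: bij_betw_def)
  have e_inj: "e i = e j \<longleftrightarrow> i = j" if "i < n" "j < n" for i j
    using e that by (auto simp: bij_betw_def inj_on_eq_iff)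
  define A :: "int mat" where
    "A = mat n n (\<lambda>(i, j). if i \<noteq> j \<and> e i \<bullet> e j = - \<alpha> then 1 else 0)"
  \<comment> \<open>With G the Gram matrix and J the all-ones matrix, \<open>A\<close> is ((b - 1) I
    - b G + J) / 2. The first \<open>d\<close> columns of \<open>U\<close> and rows of
    \<open>W\<close> factor G through coordinates, the last ones give J.\<close>
  define U where "U = mat n (d + 1) (\<lambda>(i, l). if l < d then - (b / 2) * (e i \<bullet> g l) else 1 / 2)"
  define W where "W = mat (d + 1) n (\<lambda>(l, j). if l < d then e j \<bullet> g l else 1)"
  have A: "A \<in> carrier_mat n n" and U: "U \<in> carrier_mat n (d + 1)" and W: "W \<in> carrier_mat (d + 1) n"
    by (simp_all add: A_def U_def W_def)
  have "map_mat real_of_int A = ((b - 1) / 2) \<cdot>\<^sub>m 1\<^sub>m n + U * W"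
  proof (rule eq_matI)
    fix i j assume "i < dim_row (((b - 1) / 2) \<cdot>\<^sub>m 1\<^sub>m n + U * W)" "j < dim_col (((b - 1) / 2) \<cdot>\<^sub>m 1\<^sub>m n + U * W)"
    then have ij: "i < n" "j < n" using U W by auto
    have "(\<Sum>l = 0..<d. (e i \<bullet> g l) * (e j \<bullet> g l)) = (\<Sum>k\<in>Basis. (e i \<bullet> k) * (e j \<bullet> k))"
      by (rule sum.reindex_bij_betw[OF g])
    also have "\<dots> = e i \<bullet> e j" by (rule euclidean_inner[symmetric])
    finally have "(\<Sum>l = 0..<d. - (b / 2) * (e i \<bullet> g l) * (e j \<bullet> g l)) = - (b / 2) * (e i \<bullet> e j)"
      by (simp only: mult.assoc sum_distrib_left[symmetric])
    then have UW: "(U * W) $$ (i, j) = - (b / 2) * (e i \<bullet> e j) + 1 / 2"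
      using ij by (simp add: U_def W_def scalar_prod_def)
    show "map_mat real_of_int A $$ (i, j) = (((b - 1) / 2) \<cdot>\<^sub>m 1\<^sub>m n + U * W) $$ (i, j)"
    proof (cases "i = j")
      case True
      then show ?thesis using ij UW U W unit[OF eX[of i]] by (simp add: A_def field_simps)
    next
      case False
      then have "e i \<bullet> e j = \<alpha> \<or> e i \<bullet> e j = - \<alpha>"
        using angle[of "e i" "e j"] e_inj[of i j] eX ij by blast
      then show ?thesis
        using ij UW U W False \<open>0 < \<alpha>\<close> by (auto simp: A_def b_def)
    qed
  qed (use A U W in auto)
  then have "[:- ((b - 1) / 2), 1:] ^ (n - (d + 1)) dvd char_poly (map_mat real_of_int A)"
    using U W large by (intro char_poly_dvd_of_low_rank) (auto simp: n_def d_def)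
  also have "char_poly (map_mat real_of_int A) = map_poly real_of_int (char_poly A)"
    by (rule of_int_hom.char_poly_hom[OF A])
  \<comment> \<open>The multiplicity n - d - 1 exceeds n / 2 because n > 2 d + 2.\<close>
  finally have "(b - 1) / 2 \<in> \<int>"
    using degree_monic_char_poly[OF A] large
    by (intro high_order_root_int[of "char_poly A" _ "n - (d + 1)"]) (auto simp: n_def d_def)
  then show ?thesis by (simp add: b_def)
qed

end

section \<open>Comparison of the bounds\<close>

text \<open>Refutes the trace bound after substituting \<alpha> = 1/b and multiplying by b^4. The
  second condition on \<open>n\<close> is what remains when the bound for small dimensions does not
  apply. To leading order the comparison is n b^4 / 2 against N (b - 1)^2.\<close>

lemma trace_bound_contradiction:
  fixes N n b :: real
  assumes b: "3 \<le> b" and n: "359 \<le> n" "3 * (b\<^sup>2 - 5) \<le> n + 2" and N: "n * (n + 2) / 3 \<le> N"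
  shows "n * (N * (N - 1 + b\<^sup>2) * (N - 1 + b)\<^sup>2 - N ^ 3 * (N - b ^ 4 / 2)) < N\<^sup>2 * (N - 1)\<^sup>2 * (b - 1)\<^sup>2"
proof -
  define p where "p = b\<^sup>2 - 1"
  define q where "q = b - 1"
  \<comment> \<open>\<open>H\<close> is \<open>p + 2 * q + b ^ 4 / 2 + 2\<close>: the coefficient of
    N^2 in the expansion, plus 2 to absorb the linear and constant terms, each at most N^2.\<close>
  define H where "H = b ^ 4 / 2 + b\<^sup>2 + 2 * b - 1"
  have b2: "9 \<le> b\<^sup>2" using power_mono[OF b, of 2] by simp
  have "0 < p" "0 < q" using b b2 by (simp_all add: p_def q_def)
  have "n * (b\<^sup>2 - 5) \<le> n * ((n + 2) / 3)" using n by (intro mult_left_mono) auto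
  then have "n * (b\<^sup>2 - 5) \<le> N" using N by simp
  moreover have "n * (4 / 9 * b\<^sup>2) \<le> n * (b\<^sup>2 - 5)" using n b2 by (intro mult_left_mono) auto
  moreover have "(2 * b + 1) * b\<^sup>2 \<le> (4 / 9 * n) * b\<^sup>2"
  proof (rule mult_right_mono)
    \<comment> \<open>The tangent at 10 replaces b^2 by a linear lower bound, which suffices for a
      linear estimate of \<open>b\<close> by \<open>n\<close>.\<close>
    have "0 \<le> (b - 10)\<^sup>2" by simp
    then have "20 * b - 100 \<le> b\<^sup>2" by (simp add: power2_eq_square algebra_simps)
    then have "60 * b - 317 \<le> n" using n by (smt (verit))
    then have "18 * b + 9 \<le> 4 * n" using n by linarith
    then show "2 * b + 1 \<le> 4 / 9 * n" by simp
  qed simp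
  ultimately have "2 * b ^ 3 + b\<^sup>2 \<le> N" by (simp add: power2_eq_square power3_eq_cube algebra_simps)
  moreover have "2 * p * q + q\<^sup>2 \<le> 2 * b ^ 3 + b\<^sup>2"
  proof -
    have "p * q \<le> b\<^sup>2 * b" using \<open>0 < p\<close> \<open>0 < q\<close> by (intro mult_mono) (simp_all add: p_def q_def)
    moreover have "q\<^sup>2 \<le> b\<^sup>2" using \<open>0 < q\<close> by (intro power_mono) (simp_all add: q_def)
    ultimately show ?thesis by (simp add: power2_eq_square power3_eq_cube)
  qed
  ultimately have pq: "2 * p * q + q\<^sup>2 \<le> N" by linarith
  have "0 < p * q" using \<open>0 < p\<close> \<open>0 < q\<close> by simp
  have N120: "120 * n \<le> N"
  proof -
    have "n * 120 \<le> n * ((n + 2) / 3)" using n by (intro mult_left_mono) auto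
    then show ?thesis using N by simp
  qed
  then have "0 < N" "2 < N" using n by auto
  have "3 * b \<le> b\<^sup>2" using b by (simp add: power2_eq_square)
  then have "q \<le> N"
    using N120 n b unfolding q_def by (smt (verit))
  have "p * q\<^sup>2 \<le> N\<^sup>2"
  proof -
    have "p * q \<le> 2 * (p * q)" using \<open>0 < p * q\<close> by simp
    also have "\<dots> \<le> 2 * p * q + q\<^sup>2" by simp
    also note pq
    finally have "p * q \<le> N" .
    have "(p * q) * q \<le> N * N"
      using less_imp_le[OF \<open>0 < N\<close>] less_imp_le[OF \<open>0 < q\<close>]
      by (rule mult_mono[OF \<open>p * q \<le> N\<close> \<open>q \<le> N\<close>])
    then show ?thesis by (simp add: power2_eq_square mult.assoc)
  qed
  moreover have "(2 * p * q + q\<^sup>2) * N \<le> N * N"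
    using pq \<open>0 < N\<close> by (intro mult_right_mono) auto
  moreover have "(N + p) * (N + q)\<^sup>2 - N ^ 3 + N\<^sup>2 * (b ^ 4 / 2)
      = (p + 2 * q + b ^ 4 / 2) * N\<^sup>2 + (2 * p * q + q\<^sup>2) * N + p * q\<^sup>2"
    by (simp add: power2_eq_square power3_eq_cube algebra_simps)
  moreover have "(p + 2 * q + b ^ 4 / 2) * N\<^sup>2 + N * N + N\<^sup>2 = H * N\<^sup>2"
    by (simp add: p_def q_def H_def power2_eq_square algebra_simps)
  ultimately have "(N + p) * (N + q)\<^sup>2 - N ^ 3 + N\<^sup>2 * (b ^ 4 / 2) \<le> H * N\<^sup>2"
    by linarith
  then have "n * N * ((N + p) * (N + q)\<^sup>2 - N ^ 3 + N\<^sup>2 * (b ^ 4 / 2)) \<le> n * N * (H * N\<^sup>2)"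
    using n \<open>0 < N\<close> by (intro mult_left_mono) auto
  also have "\<dots> = N ^ 3 * (n * H)" by (simp add: power2_eq_square power3_eq_cube)
  also have "\<dots> < N ^ 3 * ((N - 2) * q\<^sup>2)"
  proof (rule mult_strict_left_mono)
    have "H < (n - 1) / 3 * q\<^sup>2"
    \<comment> \<open>Up to 7 the bound \<open>359 \<le> n\<close> decides; beyond, the other
      condition gives (n - 1) / 3 at least b^2 - 6, and the shift by 7 leaves only positive
      coefficients.\<close>
    proof (cases "b \<le> 7")
      case True
      have "b\<^sup>2 \<le> 49" using True b power_mono[of b 7 2] by simp
      then have "b\<^sup>2 * b\<^sup>2 \<le> 49 * b\<^sup>2" by (intro mult_right_mono) auto
      moreover have "(2 / 3 * b)\<^sup>2 \<le> q\<^sup>2" using b by (intro power_mono) (auto simp: q_def)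
      moreover have "(359 - 1) / 3 * q\<^sup>2 \<le> (n - 1) / 3 * q\<^sup>2"
        using n by (intro mult_right_mono) auto
      moreover have "2 * b \<le> b\<^sup>2" using b by (simp add: power2_eq_square)
      ultimately show ?thesis
        by (simp add: H_def power2_eq_square power4_eq_xxxx) (use b2 in \<open>simp add: power2_eq_square\<close>)
    next
      case False
      define t where "t = b - 7"
      have "0 < t" and bt: "b = t + 7" using False by (simp_all add: t_def)
      have "(b\<^sup>2 - 6) * q\<^sup>2 - H = t ^ 4 / 2 + 12 * t ^ 3 + 99 * t\<^sup>2 + 318 * t + 571 / 2"
        by (simp add: q_def H_def bt add_divide_distrib power2_eq_square power3_eq_cube power4_eq_xxxx algebra_simps)
      also have "\<dots> > 0" using \<open>0 < t\<close> by (intro add_pos_pos) auto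
      finally have "H < (b\<^sup>2 - 6) * q\<^sup>2" by simp
      also have "\<dots> \<le> (n - 1) / 3 * q\<^sup>2" using n by (intro mult_right_mono) auto
      finally show ?thesis .
    qed
    then have "n * H < n * ((n - 1) / 3 * q\<^sup>2)" using n by simp
    also have "\<dots> = (n * (n + 2) / 3 - n) * q\<^sup>2" by (simp add: field_simps)
    also have "\<dots> \<le> (N - 2) * q\<^sup>2" using N n by (intro mult_right_mono) auto
    finally show "n * H < (N - 2) * q\<^sup>2" .
  qed (use \<open>0 < N\<close> in simp)
  also have "\<dots> \<le> N\<^sup>2 * (N - 1)\<^sup>2 * q\<^sup>2"
  proof -
    have "N * (N - 2) \<le> (N - 1)\<^sup>2" by (simp add: power2_eq_square algebra_simps)
    then have "N\<^sup>2 * q\<^sup>2 * (N * (N - 2)) \<le> N\<^sup>2 * q\<^sup>2 * (N - 1)\<^sup>2"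
      by (intro mult_left_mono) auto
    then show ?thesis by (simp add: power2_eq_square power3_eq_cube mult_ac)
  qed
  finally have "n * N * ((N + p) * (N + q)\<^sup>2 - N ^ 3 + N\<^sup>2 * (b ^ 4 / 2)) < N\<^sup>2 * (N - 1)\<^sup>2 * q\<^sup>2" .
  moreover have "n * N * ((N + p) * (N + q)\<^sup>2 - N ^ 3 + N\<^sup>2 * (b ^ 4 / 2))
      = n * (N * (N + p) * (N + q)\<^sup>2 - N ^ 3 * (N - b ^ 4 / 2))"
    by (simp add: power2_eq_square power3_eq_cube right_diff_distrib distrib_left mult_ac)
  moreover have "N - 1 + b\<^sup>2 = N + p" "N - 1 + b = N + q"
    by (simp_all add: p_def q_def)
  ultimately show ?thesis by (simp only: q_def[symmetric])
qed

text \<open>The difference is a quartic in \<open>a\<close> with nonnegative coefficients after the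
  shift by 19. For a = 17 and n = 358 the inequality fails, which explains the threshold 359 = 19^2
  - 2.\<close>

lemma target_bound:
  fixes a n :: real
  assumes "19 \<le> a" and "0 \<le> n" and "n \<le> (a + 2)\<^sup>2 - 3"
  shows "n * (n + 2) / 3 \<le> (a\<^sup>2 - 2) * (a\<^sup>2 - 1) / 2"
proof -
  define t where "t = a - 19"
  have "0 \<le> t" and at: "a = t + 19" using assms by (simp_all add: t_def)
  have "n * (n + 2) \<le> ((a + 2)\<^sup>2 - 3) * ((a + 2)\<^sup>2 - 1)"
    using assms by (intro mult_mono) auto
  moreover have "3 * ((a\<^sup>2 - 2) * (a\<^sup>2 - 1)) - 2 * (((a + 2)\<^sup>2 - 3) * ((a + 2)\<^sup>2 - 1))
      = t ^ 4 + 60 * t ^ 3 + 1205 * t\<^sup>2 + 8214 * t + 2280"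
    by (simp add: at power2_eq_square power3_eq_cube power4_eq_xxxx algebra_simps)
  moreover have "0 \<le> t ^ 4 + 60 * t ^ 3 + 1205 * t\<^sup>2 + 8214 * t + 2280"
    using \<open>0 \<le> t\<close> by (intro add_nonneg_nonneg) auto
  ultimately show ?thesis by linarith
qed

section \<open>The bound for a single equiangular set\<close>

context equiangular
begin

text \<open>The relative bound increases with \<alpha>, and at \<alpha>^2 = 1 / (n + 3) it equals n
  (n + 2) / 3.\<close>

lemma small_angle_bound:
  assumes "2 \<le> DIM('a)" and "(DIM('a) + 3) * \<alpha>\<^sup>2 \<le> 1"
  shows "N \<le> real DIM('a) * (real DIM('a) + 2) / 3"
proof (rule ccontr)
  define n where "n = real DIM('a)"
  have n: "2 \<le> n" "(n + 3) * \<alpha>\<^sup>2 \<le> 1" using assms by (simp_all add: n_def)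
  assume "\<not> ?thesis"
  then have "n * (n + 2) / 3 < N" by (simp only: n_def not_le)
  moreover have pos: "0 < 1 - n * \<alpha>\<^sup>2"
    using n by (cases "\<alpha> = 0") (simp_all add: distrib_right, smt (verit) zero_less_power2)
  ultimately have "n * (n + 2) / 3 * (1 - n * \<alpha>\<^sup>2) < N * (1 - n * \<alpha>\<^sup>2)"
    by simp
  also have "\<dots> \<le> n * (1 - \<alpha>\<^sup>2)" using relative_bound by (simp add: n_def)
  finally have "n * ((n + 2) * (1 - n * \<alpha>\<^sup>2)) < n * (3 * (1 - \<alpha>\<^sup>2))"
    by (simp add: field_simps)
  then have "(n + 2) * (1 - n * \<alpha>\<^sup>2) < 3 * (1 - \<alpha>\<^sup>2)"
    using n by simp
  then have "(n - 1) * (1 - (n + 3) * \<alpha>\<^sup>2) < 0" by (simp add: algebra_simps)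
  moreover have "0 \<le> (n - 1) * (1 - (n + 3) * \<alpha>\<^sup>2)" using n by simp
  ultimately show False by simp
qed

lemma card_bound:
  fixes a :: int
  assumes n: "359 \<le> DIM('a)" and a: "0 < a" "odd a" "int DIM('a) \<le> (a + 2)\<^sup>2 - 3"
  shows "N \<le> real_of_int ((a\<^sup>2 - 2) * (a\<^sup>2 - 1)) / 2"
proof (rule ccontr)
  define n where "n = real DIM('a)"
  define T where "T = ((real_of_int a)\<^sup>2 - 2) * ((real_of_int a)\<^sup>2 - 1) / 2"
  assume "\<not> ?thesis"
  then have NT: "T < N" by (simp add: T_def)
  have n359: "359 \<le> n" using n by (simp add: n_def)
  \<comment> \<open>An odd \<open>a\<close> below 19 is at most 17, which would give n at most 19^2
    - 3 = 358.\<close>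
  have "19 \<le> a"
  proof (rule ccontr)
    assume "\<not> 19 \<le> a"
    then have "a + 2 \<le> 19" using \<open>odd a\<close> by presburger
    then have "(a + 2)\<^sup>2 \<le> 19\<^sup>2" using a by (intro power_mono) auto
    then show False using n a by simp
  qed
  have "n \<le> (real_of_int a + 2)\<^sup>2 - 3"
  proof -
    have "real_of_int (int DIM('a)) \<le> real_of_int ((a + 2)\<^sup>2 - 3)" using a by linarith
    then show ?thesis by (simp add: n_def)
  qed
  then have "n * (n + 2) / 3 \<le> T"
    unfolding T_def using \<open>19 \<le> a\<close> n359 by (intro target_bound) auto
  then have Nn: "n * (n + 2) / 3 < N" using NT by simp
  \<comment> \<open>A crude lower bound for \<open>N\<close>, enough for the integrality argument,
    which needs N > 2 n + 2.\<close>
  have "n * 120 \<le> n * ((n + 2) / 3)" using n359 by (intro mult_left_mono) auto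
  then have "2 * n + 2 < N" using Nn n359 by linarith
  then have "real (2 * DIM('a) + 2) < N" by (simp add: n_def)
  then have large: "2 * DIM('a) + 2 < card X" by (simp only: of_nat_less_iff)
  then have "X \<noteq> {}" by auto
  have "1 < (n + 3) * \<alpha>\<^sup>2"
    using small_angle_bound n Nn by (fastforce simp: n_def)
  \<comment> \<open>Since n + 3 is at most (a + 2)^2, the inverse angle \<open>b\<close> is below a
    + 2; once it is known to be an odd integer, it is at most \<open>a\<close>.\<close>
  also have "\<dots> \<le> (real_of_int a + 2)\<^sup>2 * \<alpha>\<^sup>2"
    using \<open>n \<le> _\<close> by (intro mult_right_mono) auto
  finally have "1 < ((real_of_int a + 2) * \<alpha>)\<^sup>2" by (simp add: power_mult_distrib)
  then have "1 < (real_of_int a + 2) * \<alpha>"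
    using a \<alpha> by (smt (verit) mult_nonneg_nonneg of_int_0_less_iff power_le_one)
  then have "0 < \<alpha>" using \<alpha> by (cases "\<alpha> = 0") auto
  define b where "b = 1 / \<alpha>"
  have b: "1 < b" "b < real_of_int a + 2"
    using \<open>0 < \<alpha>\<close> \<alpha> \<open>1 < _ * \<alpha>\<close> by (simp_all add: b_def field_simps)
  have \<alpha>b: "\<alpha> = 1 / b" by (simp add: b_def)
  obtain k :: int where "(b - 1) / 2 = real_of_int k"
    using inverse_angle_odd[OF \<open>0 < \<alpha>\<close> large] by (auto simp: b_def elim: Ints_cases)
  then have bk: "b = real_of_int (2 * k + 1)" by simp
  then have "1 < 2 * k + 1" "2 * k + 1 < a + 2" using b by linarith+
  then have "3 \<le> 2 * k + 1" "2 * k + 1 \<le> a" using \<open>odd a\<close> by presburger+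
  then have b3: "3 \<le> b" and ba: "b \<le> real_of_int a" unfolding bk by linarith+
  have b2: "9 \<le> b\<^sup>2" using power_mono[OF b3, of 2] by simp
  show False
  proof (cases "(n + 2) * (\<alpha>\<^sup>2 + 3 * \<alpha> ^ 4) \<le> 3 * (1 - \<alpha>\<^sup>2)\<^sup>2")
    case True
    then have "2 * N * \<alpha> ^ 4 \<le> (1 - \<alpha>\<^sup>2) * (1 - 2 * \<alpha>\<^sup>2)"
      using large by (intro small_dimension_bound) (simp_all add: n_def add.commute)
    then have "2 * N * \<alpha> ^ 4 * b ^ 4 \<le> (1 - \<alpha>\<^sup>2) * (1 - 2 * \<alpha>\<^sup>2) * b ^ 4"
      using b3 by (intro mult_right_mono) auto
    moreover have "2 * N * \<alpha> ^ 4 * b ^ 4 = 2 * N"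
      using b3 by (simp add: \<alpha>b power_divide)
    moreover have "(1 - \<alpha>\<^sup>2) * (1 - 2 * \<alpha>\<^sup>2) * b ^ 4 = ((1 - \<alpha>\<^sup>2) * b\<^sup>2) * ((1 - 2 * \<alpha>\<^sup>2) * b\<^sup>2)"
      by (simp add: power2_eq_square power4_eq_xxxx)
    moreover have "(1 - \<alpha>\<^sup>2) * b\<^sup>2 = b\<^sup>2 - 1" "(1 - 2 * \<alpha>\<^sup>2) * b\<^sup>2 = b\<^sup>2 - 2"
      using b3 by (simp_all add: \<alpha>b power_divide left_diff_distrib)
    ultimately have "2 * N \<le> (b\<^sup>2 - 1) * (b\<^sup>2 - 2)" by simp
    also have "b\<^sup>2 \<le> (real_of_int a)\<^sup>2" using ba b3 by (intro power_mono) auto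
    then have "(b\<^sup>2 - 1) * (b\<^sup>2 - 2) \<le> ((real_of_int a)\<^sup>2 - 1) * ((real_of_int a)\<^sup>2 - 2)"
      using b2 by (intro mult_mono) auto
    finally show False using NT by (simp add: T_def mult.commute)
  next
    case False
    then have "3 * (1 - \<alpha>\<^sup>2)\<^sup>2 * b ^ 4 \<le> (n + 2) * (\<alpha>\<^sup>2 + 3 * \<alpha> ^ 4) * b ^ 4"
      using b3 by (intro mult_right_mono) auto
    moreover have "(1 - \<alpha>\<^sup>2)\<^sup>2 * b ^ 4 = ((1 - \<alpha>\<^sup>2) * b\<^sup>2)\<^sup>2"
      by (simp add: power2_eq_square power4_eq_xxxx)
    moreover have "(1 - \<alpha>\<^sup>2) * b\<^sup>2 = b\<^sup>2 - 1" "(\<alpha>\<^sup>2 + 3 * \<alpha> ^ 4) * b ^ 4 = b\<^sup>2 + 3"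
      using b3 by (simp_all add: \<alpha>b power_divide left_diff_distrib distrib_right power2_eq_square power4_eq_xxxx)
    ultimately have "3 * (b\<^sup>2 - 1)\<^sup>2 \<le> (n + 2) * (b\<^sup>2 + 3)"
      by (simp add: mult.assoc)
    \<comment> \<open>Division with remainder of (b^2 - 1)^2 by b^2 + 3; dropping the remainder 16
      lets the common factor cancel.\<close>
    moreover have "(b\<^sup>2 - 5) * (b\<^sup>2 + 3) \<le> (b\<^sup>2 - 1)\<^sup>2"
      by (simp add: power2_eq_square algebra_simps)
    ultimately have "3 * (b\<^sup>2 - 5) * (b\<^sup>2 + 3) \<le> (n + 2) * (b\<^sup>2 + 3)" by linarith
    then have "3 * (b\<^sup>2 - 5) \<le> n + 2" using b2 by (simp add: mult_le_cancel_right)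
    then have "n * (N * (N - 1 + b\<^sup>2) * (N - 1 + b)\<^sup>2 - N ^ 3 * (N - b ^ 4 / 2)) < N\<^sup>2 * (N - 1)\<^sup>2 * (b - 1)\<^sup>2"
      using b3 n359 Nn by (intro trace_bound_contradiction) auto
    moreover have "N\<^sup>2 * (N - 1)\<^sup>2 * \<alpha>\<^sup>2 * (1 - \<alpha>)\<^sup>2 * b ^ 4
      \<le> n * (N * (1 + (N - 1) * \<alpha>\<^sup>2) * (1 + (N - 1) * \<alpha>)\<^sup>2 - N ^ 3 * (N * \<alpha> ^ 4 - 1 / 2)) * b ^ 4"
      using trace_bound[OF \<open>X \<noteq> {}\<close>] b3 unfolding n_def by (intro mult_right_mono) auto
    moreover have "N\<^sup>2 * (N - 1)\<^sup>2 * \<alpha>\<^sup>2 * (1 - \<alpha>)\<^sup>2 * b ^ 4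
      = N\<^sup>2 * (N - 1)\<^sup>2 * (\<alpha> * b)\<^sup>2 * ((1 - \<alpha>) * b)\<^sup>2"
      unfolding power_mult_distrib by (simp add: power2_eq_square power4_eq_xxxx)
    moreover have "n * (N * p * q\<^sup>2 - N ^ 3 * s) * b ^ 4 = n * (N * (p * b\<^sup>2) * (q * b)\<^sup>2 - N ^ 3 * (s * b ^ 4))"
      for p q s
      by (simp add: power_mult_distrib left_diff_distrib right_diff_distrib)
    moreover have "\<alpha> * b = 1" "(1 - \<alpha>) * b = b - 1" "(1 + (N - 1) * \<alpha>\<^sup>2) * b\<^sup>2 = N - 1 + b\<^sup>2"
      "(1 + (N - 1) * \<alpha>) * b = N - 1 + b" "(N * \<alpha> ^ 4 - 1 / 2) * b ^ 4 = N - b ^ 4 / 2"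
      using b3 by (simp_all add: \<alpha>b power_divide left_diff_distrib distrib_right diff_divide_distrib)
    ultimately show False by (simp only: power_one mult_1_right not_less)
  qed
qed

end

section \<open>Passage to the maximum cardinality\<close>

lemma equiangular_set_card_le:
  fixes X :: "'a::euclidean_space set" and a :: int
  assumes "equiangular_set X"
    and "359 \<le> DIM('a)" and "0 < a" "odd a" "int DIM('a) \<le> (a + 2)\<^sup>2 - 3"
  shows "real (card X) \<le> real_of_int ((a\<^sup>2 - 2) * (a\<^sup>2 - 1)) / 2"
proof -
  obtain \<alpha> where "finite X" "X \<subseteq> sphere 0 1" "0 \<le> \<alpha>" "\<alpha> < 1"
    and \<alpha>: "\<And>x y. x \<in> X \<Longrightarrow> y \<in> X \<Longrightarrow> x \<noteq> y \<Longrightarrow> x \<bullet> y \<in> {\<alpha>, - \<alpha>}"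
    using assms(1) unfolding equiangular_set_def by auto
  then interpret equiangular X \<alpha>
    by unfold_locales (auto simp: subset_iff dot_square_norm)
  show ?thesis using assms(2-) by (rule card_bound)
qed

theorem theorem2:
  fixes a :: int
  assumes "CARD('n::finite) \<ge> 359"
    and "0 < a" and "odd a"
    and "a\<^sup>2 - 2 \<le> int CARD('n)" and "int CARD('n) \<le> (a + 2)\<^sup>2 - 3"
  shows "real (max_equiangular TYPE('n)) \<le> real_of_int ((a\<^sup>2 - 2) * (a\<^sup>2 - 1)) / 2"
proof -
  let ?C = "{card X | X :: (real ^ 'n) set. equiangular_set X}"
  let ?T = "real_of_int ((a\<^sup>2 - 2) * (a\<^sup>2 - 1)) / 2"
  have bound: "real k \<le> ?T" if "k \<in> ?C" for k
    using that equiangular_set_card_le[where 'a = "real ^ 'n" and a = a] assms by auto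
  \<comment> \<open>The bound itself makes the set of cardinalities finite, and the empty set makes
    it nonempty, so \<open>Max\<close> is attained and the bound applies to it.\<close>
  then have "?C \<subseteq> {..nat \<lfloor>?T\<rfloor>}" by (intro subsetI) (simp only: atMost_iff le_nat_floor)
  then have "finite ?C" by (rule finite_subset) simp
  moreover have "equiangular_set ({} :: (real ^ 'n) set)"
    by (auto simp: equiangular_set_def)
  then have "?C \<noteq> {}" by blast
  ultimately have "Max ?C \<in> ?C" by (rule Max_in)
  then show ?thesis unfolding max_equiangular_def by (rule bound)
qed

end
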